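(* Let $(P,\sigma)$ be a Markov operator cocycle on $L^1(X,m)$. Suppose that there is a random invariant density $\omega\mapsto h_\omega\in D(X,m)$ such that, for $\mathbb P$-almost every $\omega\in\Omega$, the sets $F_{\alpha,n}=\{x\in X:h_{\sigma^{-n}\omega}(x)>\alpha\}$ satisfy $m(F_{\alpha,n})\nearrow1$ as $\alpha\searrow0$ uniformly in $n\in\mathbb N$. Then, for $\mathbb P$-almost every $\omega\in\Omega$, the set $\{P^{(n)}_{\sigma^{-n}\omega}g\}_n$ is uniformly integrable (and hence weakly precompact) for any $g\in L^1_+(X,m)$.
   Context: Standing assumptions: $(\Omega,\mathcal F,\mathbb P)$ and $(X,\mathcal A,m)$ are probability spaces with $\Omega$ and $X$ Polish (complete separable metric) spaces, and $\sigma:\Omega\to\Omega$ is an invertible, $\mathbb P$-preserving, ergodic transformation. A linear operator $Q$ on $L^1(X,m)$ is a Markov operator if it is positive and $\int_XQf\,dm=\int_Xf\,dm$ for all $f\in L^1(X,m)$. A Markov operator cocycle $(P,\sigma)$ is given by a measurable map $P:\Omega\times L^1(X,m)\to L^1(X,m)$, $P_\omega=P(\omega,\cdot)$, with $P_\omega$ a Markov operator for $\mathbb P$-almost every $\omega$. For $n\ge1$, $P^{(n)}_\omega=P_{\sigma^{n-1}\omega}\circ\cdots\circ P_\omega$, so $P^{(n)}_{\sigma^{-n}\omega}=P_{\sigma^{-1}\omega}\circ\cdots\circ P_{\sigma^{-n}\omega}$. $L^1_+(X,m)=\{f\in L^1(X,m):f\ge0\}$ and $D(X,m)=\{f\in L^1_+(X,m):\|f\|_{L^1(X)}=1\}$.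 A random invariant density is a measurable map $h:\Omega\to L^1(X,m)$, $h(\omega)=h_\omega$, with $h_\omega\in D(X,m)$ and $P_\omega h_\omega=h_{\sigma\omega}$ for $\mathbb P$-almost every $\omega$. $\{P^{(n)}_{\sigma^{-n}\omega}g\}_n$ is uniformly integrable if for any $\varepsilon>0$ there exists $\delta>0$ such that, for $A\in\mathcal A$, $m(A)<\delta$ implies $\int_AP^{(n)}_{\sigma^{-n}\omega}g\,dm<\varepsilon$ for all $n\ge1$. A subset of $L^1(X,m)$ is weakly precompact if every sequence in it has a subsequence converging weakly in $L^1(X,m)$. *)

theory Defs
  imports "HOL-Probability.Probability"
begin

section \<open>The space \<open>L\<^sup>1(X, m)\<close>\<close>

text \<open>
  Elements are classes of integrable functions modulo equality almost everywhere.
  Pointwise expressions go through a chosen representative \<open>L1_rep F\<close>; all notions below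
  are independent of that choice.
\<close>

definition L1_class :: "'x measure \<Rightarrow> ('x \<Rightarrow> real) \<Rightarrow> ('x \<Rightarrow> real) set" where
  "L1_class M f = {g. integrable M g \<and> (AE x in M. g x = f x)}"

definition L1 :: "'x measure \<Rightarrow> ('x \<Rightarrow> real) set set" where
  "L1 M = L1_class M ` {f. integrable M f}"

definition L1_rep :: "('x \<Rightarrow> real) set \<Rightarrow> 'x \<Rightarrow> real" where
  "L1_rep F = (SOME f. f \<in> F)"

definition L1_add :: "'x measure \<Rightarrow> ('x \<Rightarrow> real) set \<Rightarrow> ('x \<Rightarrow> real) set \<Rightarrow> ('x \<Rightarrow> real) set" where
  "L1_add M F G = L1_class M (\<lambda>x. L1_rep F x + L1_rep G x)"

definition L1_scale :: "'x measure \<Rightarrow> real \<Rightarrow> ('x \<Rightarrow> real) set \<Rightarrow> ('x \<Rightarrow> real) set" where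
  "L1_scale M c F = L1_class M (\<lambda>x. c * L1_rep F x)"

definition L1_integral :: "'x measure \<Rightarrow> ('x \<Rightarrow> real) set \<Rightarrow> real" where
  "L1_integral M F = (\<integral>x. L1_rep F x \<partial>M)"

definition L1_norm :: "'x measure \<Rightarrow> ('x \<Rightarrow> real) set \<Rightarrow> real" where
  "L1_norm M F = (\<integral>x. \<bar>L1_rep F x\<bar> \<partial>M)"

definition L1_dist :: "'x measure \<Rightarrow> ('x \<Rightarrow> real) set \<Rightarrow> ('x \<Rightarrow> real) set \<Rightarrow> real" where
  "L1_dist M F G = (\<integral>x. \<bar>L1_rep F x - L1_rep G x\<bar> \<partial>M)"

definition L1_pos :: "'x measure \<Rightarrow> ('x \<Rightarrow> real) set set" where
  "L1_pos M = {F \<in> L1 M. AE x in M. 0 \<le> L1_rep F x}"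

definition L1_density :: "'x measure \<Rightarrow> ('x \<Rightarrow> real) set set" where
  "L1_density M = {F \<in> L1_pos M. L1_norm M F = 1}"

lemma L1_class_in_L1: "integrable M f \<Longrightarrow> L1_class M f \<in> L1 M"
  by (auto simp: L1_def)

lemma L1_rep_class:
  assumes "integrable M f"
  shows "integrable M (L1_rep (L1_class M f))" "AE x in M. L1_rep (L1_class M f) x = f x"
proof -
  have "f \<in> L1_class M f"
    using assms by (simp add: L1_class_def)
  then have "L1_rep (L1_class M f) \<in> L1_class M f"
    unfolding L1_rep_def by (rule someI[where P = "\<lambda>k. k \<in> L1_class M f"])
  then show "integrable M (L1_rep (L1_class M f))" "AE x in M. L1_rep (L1_class M f) x = f x"
    by (auto simp: L1_class_def)
qed

lemma L1_class_eq_iff: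
  assumes "integrable M f" "integrable M g"
  shows "L1_class M f = L1_class M g \<longleftrightarrow> (AE x in M. f x = g x)"
proof
  assume "L1_class M f = L1_class M g"
  moreover have "f \<in> L1_class M f"
    using assms by (simp add: L1_class_def)
  ultimately show "AE x in M. f x = g x"
    by (auto simp: L1_class_def)
next
  assume *: "AE x in M. f x = g x"
  have "(AE x in M. k x = f x) \<longleftrightarrow> (AE x in M. k x = g x)" for k
    using * by (auto elim: AE_mp)
  then show "L1_class M f = L1_class M g"
    by (simp add: L1_class_def)
qed

lemma L1_rep_integrable: "F \<in> L1 M \<Longrightarrow> integrable M (L1_rep F)"
  by (auto simp: L1_def L1_rep_class)

lemma L1_class_rep: "F \<in> L1 M \<Longrightarrow> L1_class M (L1_rep F) = F"
proof -
  assume "F \<in> L1 M"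
  then obtain f where f: "integrable M f" "F = L1_class M f"
    by (auto simp: L1_def)
  then show ?thesis
    using L1_rep_class[OF f(1)] by (simp add: L1_class_eq_iff)
qed

lemma Metric_space_L1: "Metric_space (L1 M) (L1_dist M)"
proof
  show "0 \<le> L1_dist M F G" for F G
    by (simp add: L1_dist_def)
  show "L1_dist M F G = L1_dist M G F" for F G
    by (simp add: L1_dist_def abs_minus_commute)
  show "L1_dist M F G = 0 \<longleftrightarrow> F = G" if "F \<in> L1 M" "G \<in> L1 M" for F G
  proof -
    have "L1_dist M F G = 0 \<longleftrightarrow> (AE x in M. \<bar>L1_rep F x - L1_rep G x\<bar> = 0)"
      unfolding L1_dist_def using that
      by (intro integral_nonneg_eq_0_iff_AE) (auto intro!: L1_rep_integrable)
    also have "\<dots> \<longleftrightarrow> L1_class M (L1_rep F) = L1_class M (L1_rep G)"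
      using that by (simp add: L1_class_eq_iff L1_rep_integrable)
    finally show ?thesis
      using that by (simp add: L1_class_rep)
  qed
  show "L1_dist M F H \<le> L1_dist M F G + L1_dist M G H"
    if "F \<in> L1 M" "G \<in> L1 M" "H \<in> L1 M" for F G H
  proof -
    have i: "integrable M (L1_rep F)" "integrable M (L1_rep G)" "integrable M (L1_rep H)"
      using that by (auto intro: L1_rep_integrable)
    have "L1_dist M F H \<le> (\<integral>x. \<bar>L1_rep F x - L1_rep G x\<bar> + \<bar>L1_rep G x - L1_rep H x\<bar> \<partial>M)"
      unfolding L1_dist_def using i by (intro integral_mono) auto
    also have "\<dots> = L1_dist M F G + L1_dist M G H"
      unfolding L1_dist_def using i by (intro Bochner_Integration.integral_add) auto
    finally show ?thesis .
  qed
qed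

definition L1_borel :: "'x measure \<Rightarrow> ('x \<Rightarrow> real) set measure" where
  "L1_borel M = sigma (L1 M) {U. openin (Metric_space.mtopology (L1 M) (L1_dist M)) U}"

definition L1_bounded_linear_functional :: "'x measure \<Rightarrow> (('x \<Rightarrow> real) set \<Rightarrow> real) \<Rightarrow> bool" where
  "L1_bounded_linear_functional M \<phi> \<longleftrightarrow>
    (\<forall>F\<in>L1 M. \<forall>G\<in>L1 M. \<phi> (L1_add M F G) = \<phi> F + \<phi> G) \<and>
    (\<forall>c. \<forall>F\<in>L1 M. \<phi> (L1_scale M c F) = c * \<phi> F) \<and>
    (\<exists>C. \<forall>F\<in>L1 M. \<bar>\<phi> F\<bar> \<le> C * L1_norm M F)"

definition L1_weak_tendsto ::
    "'x measure \<Rightarrow> (nat \<Rightarrow> ('x \<Rightarrow> real) set) \<Rightarrow> ('x \<Rightarrow> real) set \<Rightarrow> bool" where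
  "L1_weak_tendsto M u F \<longleftrightarrow>
    (\<forall>\<phi>. L1_bounded_linear_functional M \<phi> \<longrightarrow> (\<lambda>k. \<phi> (u k)) \<longlonglongrightarrow> \<phi> F)"

text \<open>The weak limit is not required to lie in \<open>S\<close>.\<close>

definition L1_weakly_precompact :: "'x measure \<Rightarrow> ('x \<Rightarrow> real) set set \<Rightarrow> bool" where
  "L1_weakly_precompact M S \<longleftrightarrow> S \<subseteq> L1 M \<and>
    (\<forall>u. (\<forall>k. u k \<in> S) \<longrightarrow>
      (\<exists>r. strict_mono (r :: nat \<Rightarrow> nat) \<and> (\<exists>F\<in>L1 M. L1_weak_tendsto M (u \<circ> r) F)))"

text \<open>
  There is no absolute value under the integral: the notion is applied only to sets of
  nonnegative elements.
\<close>

definition L1_uniformly_integrable :: "'x measure \<Rightarrow> ('x \<Rightarrow> real) set set \<Rightarrow> bool" where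
  "L1_uniformly_integrable M S \<longleftrightarrow>
    (\<forall>\<epsilon>>0. \<exists>\<delta>>0. \<forall>A\<in>sets M. measure M A < \<delta> \<longrightarrow>
      (\<forall>F\<in>S. (LINT x:A|M. L1_rep F x) < \<epsilon>))"


section \<open>Markov operator cocycles\<close>

text \<open>
  An invertible transformation is a bijection that is measurable together with its inverse.
\<close>

definition invertible_ergodic :: "'w measure \<Rightarrow> ('w \<Rightarrow> 'w) \<Rightarrow> bool" where
  "invertible_ergodic N \<sigma> \<longleftrightarrow>
    bij \<sigma> \<and> \<sigma> \<in> measurable N N \<and> inv \<sigma> \<in> measurable N N \<and>
    (\<forall>A\<in>sets N. emeasure N (\<sigma> -` A \<inter> space N) = emeasure N A) \<and>
    (\<forall>A\<in>sets N. \<sigma> -` A \<inter> space N = A \<longrightarrow> measure N A = 0 \<or> measure N A = 1)"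

definition markov_operator ::
    "'x measure \<Rightarrow> (('x \<Rightarrow> real) set \<Rightarrow> ('x \<Rightarrow> real) set) \<Rightarrow> bool" where
  "markov_operator M Q \<longleftrightarrow>
    (\<forall>F\<in>L1 M. Q F \<in> L1 M) \<and>
    (\<forall>F\<in>L1 M. \<forall>G\<in>L1 M. Q (L1_add M F G) = L1_add M (Q F) (Q G)) \<and>
    (\<forall>c. \<forall>F\<in>L1 M. Q (L1_scale M c F) = L1_scale M c (Q F)) \<and>
    (\<forall>F\<in>L1_pos M. Q F \<in> L1_pos M) \<and>
    (\<forall>F\<in>L1 M. L1_integral M (Q F) = L1_integral M F)"

definition markov_operator_cocycle ::
    "'w measure \<Rightarrow> 'x measure \<Rightarrow> ('w \<Rightarrow> ('x \<Rightarrow> real) set \<Rightarrow> ('x \<Rightarrow> real) set) \<Rightarrow> bool" where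
  "markov_operator_cocycle N M P \<longleftrightarrow>
    (\<lambda>(\<omega>, F). P \<omega> F) \<in> measurable (N \<Otimes>\<^sub>M L1_borel M) (L1_borel M) \<and>
    (AE \<omega> in N. markov_operator M (P \<omega>))"

text \<open>\<open>cocycle_iter P \<sigma> n \<omega>\<close> is the composition
  \<open>P (\<sigma>\<^sup>n\<^sup>-\<^sup>1 \<omega>) \<circ> \<dots> \<circ> P \<omega>\<close>.\<close>

primrec cocycle_iter :: "('w \<Rightarrow> 'c \<Rightarrow> 'c) \<Rightarrow> ('w \<Rightarrow> 'w) \<Rightarrow> nat \<Rightarrow> 'w \<Rightarrow> 'c \<Rightarrow> 'c" where
  "cocycle_iter P \<sigma> 0 \<omega> = id"
| "cocycle_iter P \<sigma> (Suc n) \<omega> = P ((\<sigma> ^^ n) \<omega>) \<circ> cocycle_iter P \<sigma> n \<omega>"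

definition random_invariant_density ::
    "'w measure \<Rightarrow> 'x measure \<Rightarrow> ('w \<Rightarrow> ('x \<Rightarrow> real) set \<Rightarrow> ('x \<Rightarrow> real) set) \<Rightarrow> ('w \<Rightarrow> 'w) \<Rightarrow>
      ('w \<Rightarrow> ('x \<Rightarrow> real) set) \<Rightarrow> bool" where
  "random_invariant_density N M P \<sigma> h \<longleftrightarrow>
    h \<in> measurable N (L1_borel M) \<and>
    (AE \<omega> in N. h \<omega> \<in> L1_density M \<and> P \<omega> (h \<omega>) = h (\<sigma> \<omega>))"

end

theory Submission
  imports Defs "HOL-Complex_Analysis.Great_Picard"
begin

text \<open>
  Fix a good \<open>\<omega>\<close> and write \<open>Q n\<close> for the composition of the cocycle from time \<open>-n\<close> to time
  \<open>0\<close> and \<open>H n\<close> for the invariant density at time \<open>-n\<close>. Each \<open>Q n\<close> is a Markov operator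
  and \<open>Q n\<close> maps \<open>H n\<close> to the single function \<open>H0\<close>, the density at time \<open>0\<close>. For \<open>g\<close>
  and \<open>c \<ge> 0\<close> split off the part of \<open>g\<close> that exceeds \<open>c H n\<close>. Positivity gives
  \<open>Q n g \<le> c H0 + Q n ((g - c H n)\<^sup>+)\<close>, and since \<open>Q n\<close> preserves integrals, the second
  summand has integral \<open>\<integral> (g - c H n)\<^sup>+\<close>. The latter is small uniformly in \<open>n\<close>: with
  \<open>c = K / \<alpha>\<close> it is at most \<open>\<integral> (g - K)\<^sup>+ + K m {H n \<le> \<alpha>}\<close>; choose first \<open>K\<close>, then \<open>\<alpha>\<close> by
  the assumed uniform convergence. Once \<open>c\<close> is fixed, \<open>c \<integral>\<^sub>A H0\<close> is small for small \<open>m A\<close>.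
  This is uniform integrability; see \<open>markov_operator_set_integral_le\<close>,
  \<open>integral_excess_over_multiple_le\<close> and \<open>markov_images_uniformly_integrable\<close>. The statement
  for almost every \<open>\<omega>\<close> follows because the inverse of \<open>\<sigma>\<close> also preserves the measure, so that
  what holds almost everywhere holds along almost every whole backward orbit
  (\<open>AE_backward_orbit\<close>).

  Weak precompactness is the sufficiency half of the Dunford--Pettis theorem for nonnegative
  functions (\<open>uniformly_integrable_imp_weakly_precompact\<close>). The \<open>\<sigma>\<close>-algebra of \<open>m\<close> may be
  strictly larger than the Borel sets, so it need not be generated by countably many sets up to null
  sets; but a given sequence is measurable with respect to a countably generated sub-\<open>\<sigma>\<close>-algebra
  \<open>G\<close>. There a diagonal argument on a countable generator, extended to all of \<open>G\<close> by the
  \<open>\<pi>\<close>-\<open>\<lambda>\<close> theorem and uniform integrability, makes the integrals over every set of \<open>G\<close>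
  converge along a subsequence; the limits form a measure, whose Radon--Nikodym density is the weak
  limit (\<open>setwise_convergent_subsequence\<close>). Conditional expectation onto \<open>G\<close> passes from test
  functions measurable for \<open>G\<close> to all bounded ones (\<open>weakly_convergent_subsequence\<close>), and
  these exhaust the dual of \<open>L\<^sup>1\<close> (\<open>L1_functional_bounded_density\<close>).
\<close>

section \<open>Densities of set functions and bounded test functions\<close>

text \<open>
  A form of the Radon--Nikodym theorem for set functions obtained as limits or from functionals, for
  which finite additivity and smallness on small sets are what one knows directly. Decreasing sequences of sets with empty
  intersection have measure tending to \<open>0\<close>, so the smallness condition forces continuity at the
  empty set, and with finite additivity this is \<open>\<sigma>\<close>-additivity.
\<close>

lemma (in finite_measure) absolutely_continuous_set_function_has_density:
  fixes \<nu> :: "'a set \<Rightarrow> real"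
  assumes nonneg: "\<And>A. A \<in> sets M \<Longrightarrow> 0 \<le> \<nu> A"
    and additive: "\<And>A B. A \<in> sets M \<Longrightarrow> B \<in> sets M \<Longrightarrow> A \<inter> B = {} \<Longrightarrow> \<nu> (A \<union> B) = \<nu> A + \<nu> B"
    and small: "\<And>\<epsilon>. 0 < \<epsilon> \<Longrightarrow> \<exists>\<delta>>0. \<forall>A\<in>sets M. measure M A < \<delta> \<longrightarrow> \<nu> A < \<epsilon>"
  obtains f where "f \<in> borel_measurable M" "\<And>x. 0 \<le> f x" "integrable M f"
    "\<And>A. A \<in> sets M \<Longrightarrow> \<nu> A = (LINT x:A|M. f x)"
proof -
  let ?\<nu> = "\<lambda>A. ennreal (\<nu> A)"
  have "\<nu> ({} \<union> {}) = \<nu> {} + \<nu> {}"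
    by (rule additive) auto
  then have empty: "\<nu> {} = 0"
    by simp
  have tendsto: "(\<lambda>i. \<nu> (A i)) \<longlonglongrightarrow> 0"
    if A: "range A \<subseteq> sets M" "decseq A" "(\<Inter>i. A i) = {}" for A
  proof (rule LIMSEQ_I)
    fix e :: real assume "0 < e"
    then obtain d where d: "d > 0" "\<And>A. A \<in> sets M \<Longrightarrow> measure M A < d \<Longrightarrow> \<nu> A < e"
      using small by blast
    have "(\<lambda>i. measure M (A i)) \<longlonglongrightarrow> 0"
      using finite_Lim_measure_decseq[OF A(1,2)] A(3) by simp
    then obtain k where k: "\<And>i. i \<ge> k \<Longrightarrow> measure M (A i) < d"
      using LIMSEQ_D[of "\<lambda>i. measure M (A i)" 0 d] \<open>0 < d\<close> by auto
    have "norm (\<nu> (A i) - 0) < e" if "i \<ge> k" for i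
      using d(2)[of "A i"] k[OF that] A(1) nonneg[of "A i"] by (auto simp: range_subsetD)
    then show "\<exists>k. \<forall>i\<ge>k. norm (\<nu> (A i) - 0) < e"
      by blast
  qed
  have positive: "positive (sets M) ?\<nu>"
    by (simp add: positive_def empty)
  have "countably_additive (sets M) ?\<nu>"
  proof (rule sets.empty_continuous_imp_countably_additive[OF positive])
    show "Measure_Space.additive (sets M) ?\<nu>"
      by (auto simp: additive_def additive nonneg)
    show "(\<lambda>i. ?\<nu> (A i)) \<longlonglongrightarrow> 0"
      if A: "range A \<subseteq> sets M" "decseq A" "(\<Inter>i. A i) = {}" for A
      using tendsto_ennrealI[OF tendsto[OF A]] by simp
  qed auto
  then have "measure_space (space M) (sets M) ?\<nu>"
    using positive by (simp add: measure_space_def sets.sigma_algebra_axioms)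
  define N where "N = measure_of (space M) (sets M) ?\<nu>"
  have sets_N [simp]: "sets N = sets M" and space_N [simp]: "space N = space M"
    by (simp_all add: N_def)
  have emeasure_N: "emeasure N A = \<nu> A" if "A \<in> sets M" for A
    unfolding N_def using \<open>countably_additive (sets M) ?\<nu>\<close> positive that
    by (intro emeasure_measure_of) (auto dest: sets.sets_into_space)
  interpret N: finite_measure N
    by (rule finite_measureI) (simp add: emeasure_N)
  have "absolutely_continuous M N"
  proof (unfold absolutely_continuous_def, safe)
    fix A assume A: "A \<in> null_sets M"
    then have "A \<in> sets M" "measure M A = 0"
      by (auto simp: measure_def)
    then have "\<nu> A < e" if "0 < e" for e
      using small[OF that] by auto
    then have "\<nu> A \<le> 0"
      by (meson not_le less_irrefl)
    then show "A \<in> null_sets N"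
      using A nonneg[of A] by (auto simp: null_sets_def emeasure_N)
  qed
  then obtain f where f: "f \<in> borel_measurable M" "AE x in M. RN_deriv M N x = ennreal (f x)"
      "\<And>x. 0 \<le> f x"
    using real_RN_deriv[OF N.finite_measure_axioms _ sets_N] by metis
  have density: "density M (RN_deriv M N) = N"
    by (rule density_RN_deriv) (use \<open>absolutely_continuous M N\<close> in auto)
  have nn: "(\<integral>\<^sup>+x. ennreal (f x) * indicator A x \<partial>M) = ennreal (\<nu> A)" if A: "A \<in> sets M" for A
  proof -
    have "(\<integral>\<^sup>+x. ennreal (f x) * indicator A x \<partial>M) = (\<integral>\<^sup>+x. RN_deriv M N x * indicator A x \<partial>M)"
      using f(2) by (intro nn_integral_cong_AE) auto
    also have "\<dots> = emeasure (density M (RN_deriv M N)) A"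
      using A by (simp add: emeasure_density)
    finally show ?thesis
      using A by (simp add: density emeasure_N)
  qed
  have integrable: "integrable M f"
  proof (rule integrableI_nonneg)
    have "(\<integral>\<^sup>+x. ennreal (f x) \<partial>M) = (\<integral>\<^sup>+x. ennreal (f x) * indicator (space M) x \<partial>M)"
      by (intro nn_integral_cong) auto
    also have "\<dots> < \<infinity>"
      by (subst nn) auto
    finally show "(\<integral>\<^sup>+x. ennreal (f x) \<partial>M) < \<infinity>" .
  qed (use f in auto)
  have "\<nu> A = (LINT x:A|M. f x)" if A: "A \<in> sets M" for A
  proof -
    have "ennreal (LINT x:A|M. f x) = (\<integral>\<^sup>+x. ennreal (indicator A x * f x) \<partial>M)"
      unfolding set_lebesgue_integral_def real_scaleR_def
      using A f integrable by (intro nn_integral_eq_integral[symmetric] integrable_real_mult_indicator[of A, unfolded mult.commute[of _ "indicator A _"]]) auto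
    also have "\<dots> = (\<integral>\<^sup>+x. ennreal (f x) * indicator A x \<partial>M)"
      by (intro nn_integral_cong) (auto simp: indicator_def)
    also have "\<dots> = ennreal (\<nu> A)"
      by (rule nn[OF A])
    finally have "ennreal (LINT x:A|M. f x) = ennreal (\<nu> A)" .
    moreover have "0 \<le> (LINT x:A|M. f x)"
      by (simp add: set_lebesgue_integral_def f)
    ultimately show ?thesis
      using nonneg[OF A] by simp
  qed
  then show ?thesis
    using that f integrable by blast
qed

text \<open>
  A bounded \<open>\<phi>\<close> is a uniform limit of simple functions, for which the claim is immediate; the
  common bound on the \<open>L\<^sup>1\<close> norms makes the approximation error uniform in \<open>k\<close>.
\<close>

lemma integral_times_bounded_tendsto_0:
  fixes g :: "nat \<Rightarrow> 'a \<Rightarrow> real"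
  assumes g: "\<And>k. integrable M (g k)"
    and B: "\<And>k. (\<integral>x. \<bar>g k x\<bar> \<partial>M) \<le> B"
    and sets: "\<And>A. A \<in> sets M \<Longrightarrow> (\<lambda>k. LINT x:A|M. g k x) \<longlonglongrightarrow> 0"
    and \<phi> [measurable]: "\<phi> \<in> borel_measurable M"
    and C: "\<And>x. \<bar>\<phi> x\<bar> \<le> C"
  shows "(\<lambda>k. \<integral>x. g k x * \<phi> x \<partial>M) \<longlonglongrightarrow> 0"
proof (rule LIMSEQ_I)
  fix e :: real assume "0 < e"
  obtain n :: nat where "2 * (\<bar>B\<bar> + 1) / e < real n"
    using reals_Archimedean2 by blast
  have "0 < 2 * (\<bar>B\<bar> + 1) / e"
    using \<open>0 < e\<close> by simp
  then have n: "0 < real n"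
    using \<open>2 * (\<bar>B\<bar> + 1) / e < real n\<close> by linarith
  then have Bn: "B / real n < e / 2"
    using \<open>2 * (\<bar>B\<bar> + 1) / e < real n\<close> \<open>0 < e\<close> by (simp add: field_simps)
  \<comment> \<open>Rounding \<open>\<phi>\<close> down to a multiple of \<open>1 / n\<close> gives a simple function \<open>s\<close>, with values indexed by \<open>J\<close>.\<close>
  define J where "J = {\<lfloor>- (real n * C)\<rfloor>..\<lfloor>real n * C\<rfloor>}"
  define A where "A j = {x \<in> space M. \<lfloor>real n * \<phi> x\<rfloor> = j}" for j
  define s where "s x = (\<Sum>j\<in>J. (real_of_int j / n) * indicator (A j) x)" for x :: 'a
  have A [measurable]: "A j \<in> sets M" for j
    unfolding A_def by measurable
  have s: "s x = \<lfloor>real n * \<phi> x\<rfloor> / n" if "x \<in> space M" for x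
  proof -
    have "\<bar>real n * \<phi> x\<bar> \<le> real n * C"
      using C[of x] n by (simp add: abs_mult)
    then have "- (real n * C) \<le> real n * \<phi> x" "real n * \<phi> x \<le> real n * C"
      by linarith+
    then have "\<lfloor>real n * \<phi> x\<rfloor> \<in> J"
      by (auto simp: J_def intro!: floor_mono)
    moreover have "s x = (\<Sum>j\<in>J. if j = \<lfloor>real n * \<phi> x\<rfloor> then real_of_int j / n else 0)"
      unfolding s_def using that by (intro sum.cong) (auto simp: A_def)
    ultimately show ?thesis
      by (simp add: J_def)
  qed
  have close: "\<bar>\<phi> x - s x\<bar> \<le> 1 / n" if "x \<in> space M" for x
  proof -
    have "\<bar>real n * \<phi> x - \<lfloor>real n * \<phi> x\<rfloor>\<bar> \<le> 1"
      by linarith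
    then have "\<bar>real n * \<phi> x - \<lfloor>real n * \<phi> x\<rfloor>\<bar> / n \<le> 1 / n"
      using n by (simp add: divide_right_mono)
    also have "\<bar>real n * \<phi> x - \<lfloor>real n * \<phi> x\<rfloor>\<bar> / n
        = \<bar>(real n * \<phi> x - \<lfloor>real n * \<phi> x\<rfloor>) / n\<bar>"
      using n by simp
    also have "\<dots> = \<bar>\<phi> x - s x\<bar>"
      using n s[OF that] by (simp add: diff_divide_distrib)
    finally show ?thesis .
  qed
  have [measurable]: "s \<in> borel_measurable M"
    unfolding s_def by measurable
  have gA: "integrable M (\<lambda>x. g k x * indicator (A j) x)" for k j
    using g[of k] by (intro integrable_real_mult_indicator) auto
  have gs: "integrable M (\<lambda>x. g k x * s x)" and
    int_gs: "(\<integral>x. g k x * s x \<partial>M) = (\<Sum>j\<in>J. (real_of_int j / n) * (LINT x:A j|M. g k x))" for k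
  proof -
    have eq: "g k x * s x = (\<Sum>j\<in>J. (real_of_int j / n) * (g k x * indicator (A j) x))" for x
      unfolding s_def by (simp add: sum_distrib_left mult.left_commute)
    show "integrable M (\<lambda>x. g k x * s x)"
      unfolding eq using gA by (intro Bochner_Integration.integrable_sum integrable_mult_right) auto
    show "(\<integral>x. g k x * s x \<partial>M) = (\<Sum>j\<in>J. (real_of_int j / n) * (LINT x:A j|M. g k x))"
      unfolding eq using gA
      by (subst Bochner_Integration.integral_sum)
        (auto simp: set_lebesgue_integral_def mult.commute intro!: integrable_mult_right)
  qed
  have "(\<lambda>k. \<integral>x. g k x * s x \<partial>M) \<longlonglongrightarrow> (\<Sum>j\<in>J. (real_of_int j / n) * 0)"
    unfolding int_gs by (intro tendsto_intros sets A)
  then obtain k0 where k0: "\<And>k. k \<ge> k0 \<Longrightarrow> \<bar>\<integral>x. g k x * s x \<partial>M\<bar> < e / 2"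
    using LIMSEQ_D[of _ 0 "e / 2"] \<open>0 < e\<close> by fastforce
  have g\<phi>: "integrable M (\<lambda>x. g k x * \<phi> x)" for k
    using C by (intro Bochner_Integration.integrable_bound[OF integrable_mult_right[OF g[of k], of C]])
      (use g[of k] in \<open>auto simp: abs_mult mult.commute intro!: AE_I2 mult_right_mono order.trans[OF C abs_ge_self]\<close>)
  have "\<bar>\<integral>x. g k x * \<phi> x \<partial>M\<bar> < e" if "k \<ge> k0" for k
  proof -
    have "\<bar>(\<integral>x. g k x * \<phi> x \<partial>M) - (\<integral>x. g k x * s x \<partial>M)\<bar> = \<bar>\<integral>x. g k x * \<phi> x - g k x * s x \<partial>M\<bar>"
      using g\<phi> gs by simp
    also have "\<dots> \<le> (\<integral>x. \<bar>g k x * \<phi> x - g k x * s x\<bar> \<partial>M)"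
      by (rule integral_abs_bound)
    also have "\<dots> \<le> (\<integral>x. \<bar>g k x\<bar> * (1 / n) \<partial>M)"
    proof (rule integral_mono)
      show "\<bar>g k x * \<phi> x - g k x * s x\<bar> \<le> \<bar>g k x\<bar> * (1 / n)" if "x \<in> space M" for x
        unfolding right_diff_distrib[symmetric] abs_mult by (intro mult_left_mono close that) simp
    qed (use g\<phi> gs g in auto)
    also have "\<dots> \<le> B / n"
      using B[of k] n by (simp add: divide_right_mono)
    finally show ?thesis
      using k0[OF that] Bn by linarith
  qed
  then show "\<exists>k0. \<forall>k\<ge>k0. norm ((\<integral>x. g k x * \<phi> x \<partial>M) - 0) < e"
    by auto
qed

section \<open>Weakly convergent subsequences of uniformly integrable sequences\<close>

text \<open>
  Diagonal extraction gives convergence of the integrals over the countably many sets of \<open>C\<close>.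
  The sets over which the integrals converge form a Dynkin system: complements are handled by
  subtraction from the whole space, which is why that space is required to lie in \<open>C\<close>, and
  countable disjoint unions by uniform integrability.
\<close>

lemma (in finite_measure) setwise_convergent_subsequence:
  fixes f :: "nat \<Rightarrow> 'a \<Rightarrow> real"
  assumes gen: "sets M = sigma_sets (space M) C" "countable C" "Int_stable C"
      "C \<subseteq> Pow (space M)" "space M \<in> C"
    and f: "\<And>k. integrable M (f k)" "\<And>k x. 0 \<le> f k x"
    and B: "\<And>k. (\<integral>x. f k x \<partial>M) \<le> B"
    and ui: "\<And>\<epsilon>. 0 < \<epsilon> \<Longrightarrow>
      \<exists>\<delta>>0. \<forall>A\<in>sets M. measure M A < \<delta> \<longrightarrow> (\<forall>k. (LINT x:A|M. f k x) < \<epsilon>)"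
  obtains r F where "strict_mono (r :: nat \<Rightarrow> nat)" "integrable M F"
    "\<And>A. A \<in> sets M \<Longrightarrow> (\<lambda>k. LINT x:A|M. f (r k) x) \<longlonglongrightarrow> (LINT x:A|M. F x)"
proof -
  define I where "I k A = (LINT x:A|M. f k x)" for k A
  have f_set: "set_integrable M A (f k)" if "A \<in> sets M" for A k
    unfolding set_integrable_def using integrable_mult_indicator[OF that f(1)] .
  have I_nonneg: "0 \<le> I k A" for k A
    by (simp add: I_def set_lebesgue_integral_def f)
  have I_Un: "I k (A \<union> A') = I k A + I k A'"
    if "A \<in> sets M" "A' \<in> sets M" "A \<inter> A' = {}" for k A A'
    unfolding I_def by (rule set_integral_Un) (use that f_set in auto)
  have I_le: "I k A \<le> B" if A: "A \<in> sets M" for k A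
  proof -
    have "I k A \<le> I k A + I k (space M - A)"
      using I_nonneg by simp
    also have "\<dots> = I k (space M)"
      using sets.sets_into_space[OF A] A by (subst I_Un[symmetric]) (auto simp: Un_absorb1)
    also have "\<dots> \<le> B"
      using B[of k] by (simp add: I_def set_integral_space f)
    finally show ?thesis .
  qed
  have C_sets: "A \<in> sets M" if "A \<in> C" for A
    using that gen(1) by auto
  obtain r where r: "strict_mono r" and conv_C: "\<And>A. A \<in> C \<Longrightarrow> \<exists>l. (\<lambda>k. I (r k) A) \<longlonglongrightarrow> l"
    using function_convergent_subsequence[of C I B] gen(2) I_le[OF C_sets] I_nonneg by auto
  have conv: "convergent (\<lambda>k. I (r k) A)" if A: "A \<in> sets M" for A
    using gen(3,4) A[unfolded gen(1)]
  proof (induction rule: sigma_sets_induct_disjoint)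
    case (basic A)
    then show ?case
      using conv_C by (auto simp: convergent_def)
  next
    case empty
    then show ?case
      by (simp add: I_def set_lebesgue_integral_def convergent_const)
  next
    case (compl A)
    then have A: "A \<in> sets M"
      by (simp add: gen(1))
    have "I k (space M - A) = I k (space M) - I k A" for k
      using I_Un[of A "space M - A" k] sets.sets_into_space[OF A] A by (simp add: Un_absorb1)
    then show ?case
      using compl.IH conv_C[OF gen(5)] by (simp add: convergent_diff convergent_def[of "\<lambda>k. I (r k) (space M)"])
  next
    case (union A)
    then have A: "A i \<in> sets M" for i
      by (auto simp: gen(1))
    define U where "U n = (\<Union>i<n. A i)" for n :: nat
    define T where "T n = (\<Union>i. A i) - U n" for n
    have U: "U n \<in> sets M" and T: "T n \<in> sets M" for n
      using A by (auto simp: U_def T_def)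
    have conv_U: "convergent (\<lambda>k. I (r k) (U n))" for n
    proof (induction n)
      case 0
      then show ?case
        by (simp add: U_def I_def set_lebesgue_integral_def convergent_const)
    next
      case (Suc n)
      have "A i \<inter> A n = {}" if "i < n" for i
        using \<open>disjoint_family A\<close> that by (auto simp: disjoint_family_on_def)
      then have "U n \<inter> A n = {}"
        by (auto simp: U_def)
      moreover have "U (Suc n) = U n \<union> A n"
        by (auto simp: U_def lessThan_Suc)
      ultimately show ?case
        using Suc union.IH by (simp add: I_Un U A convergent_add)
    qed
    \<comment> \<open>Convergence on the finite unions \<open>U n\<close> carries over to the full union since the tails \<open>T n\<close> contribute little, uniformly in \<open>k\<close>.\<close>
    have "decseq T"
      by (auto simp: T_def U_def decseq_def)
    moreover have "(\<Inter>n. T n) = {}"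
      by (auto simp: T_def U_def)
    ultimately have T_0: "(\<lambda>n. measure M (T n)) \<longlonglongrightarrow> 0"
      using finite_Lim_measure_decseq[of T] T by auto
    have I_split: "I k (\<Union>i. A i) = I k (U n) + I k (T n)" for k n
    proof -
      have "U n \<union> T n = (\<Union>i. A i)" "U n \<inter> T n = {}"
        by (auto simp: T_def U_def)
      then show ?thesis
        using I_Un[OF U T, of n n k] by simp
    qed
    have "Cauchy (\<lambda>k. I (r k) (\<Union>i. A i))"
    proof (rule CauchyI)
      fix e :: real assume "0 < e"
      then obtain d where d: "0 < d"
        "\<And>A k. A \<in> sets M \<Longrightarrow> measure M A < d \<Longrightarrow> I k A < e / 2"
        using ui[of "e / 2"] by (auto simp: I_def)
      obtain n where "measure M (T n) < d"
        using LIMSEQ_D[OF T_0 d(1)] by auto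
      then have tail: "I k (T n) < e / 2" for k
        using d(2) T by blast
      have "Cauchy (\<lambda>k. I (r k) (U n))"
        using conv_U by (simp add: Cauchy_convergent_iff)
      then obtain K where K: "\<And>p q. p \<ge> K \<Longrightarrow> q \<ge> K \<Longrightarrow> \<bar>I (r p) (U n) - I (r q) (U n)\<bar> < e / 2"
        using CauchyD[of _ "e / 2"] \<open>0 < e\<close> by (metis half_gt_zero real_norm_def)
      have "\<bar>I (r p) (\<Union>i. A i) - I (r q) (\<Union>i. A i)\<bar> < e" if "p \<ge> K" "q \<ge> K" for p q
        using K[OF that] tail[of "r p"] tail[of "r q"] I_nonneg[of "r p" "T n"] I_nonneg[of "r q" "T n"]
        unfolding I_split[of _ n] by linarith
      then show "\<exists>K. \<forall>p\<ge>K. \<forall>q\<ge>K. norm (I (r p) (\<Union>i. A i) - I (r q) (\<Union>i. A i)) < e"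
        by auto
    qed
    then show ?case
      by (rule Cauchy_convergent)
  qed
  define \<nu> where "\<nu> A = lim (\<lambda>k. I (r k) A)" for A
  have \<nu>: "(\<lambda>k. I (r k) A) \<longlonglongrightarrow> \<nu> A" if "A \<in> sets M" for A
    unfolding \<nu>_def using conv[OF that] by (rule convergent_LIMSEQ_iff[THEN iffD1])
  obtain F where F: "integrable M F" "\<And>A. A \<in> sets M \<Longrightarrow> \<nu> A = (LINT x:A|M. F x)"
  proof (rule absolutely_continuous_set_function_has_density[of \<nu>])
    show "0 \<le> \<nu> A" if "A \<in> sets M" for A
      using \<nu>[OF that] by (rule LIMSEQ_le_const) (auto simp: I_nonneg)
    show "\<nu> (A \<union> A') = \<nu> A + \<nu> A'" if "A \<in> sets M" "A' \<in> sets M" "A \<inter> A' = {}" for A A'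
      using \<nu>[of "A \<union> A'"] tendsto_add[OF \<nu>[OF that(1)] \<nu>[OF that(2)]] that
      by (simp add: I_Un LIMSEQ_unique)
    show "\<exists>\<delta>>0. \<forall>A\<in>sets M. measure M A < \<delta> \<longrightarrow> \<nu> A < e" if e: "0 < e" for e
    proof -
      obtain d where d: "0 < d"
        "\<And>A k. A \<in> sets M \<Longrightarrow> measure M A < d \<Longrightarrow> I k A < e / 2"
        using ui[of "e / 2"] e by (auto simp: I_def)
      have "\<nu> A < e" if "A \<in> sets M" "measure M A < d" for A
      proof -
        have "\<nu> A \<le> e / 2"
          using \<nu>[OF that(1)] by (rule LIMSEQ_le_const2) (use d(2)[OF that] in \<open>auto intro: less_imp_le\<close>)
        then show ?thesis
          using e by linarith
      qed
      then show ?thesis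
        using d(1) by blast
    qed
  qed blast
  show ?thesis
    using that[OF r F(1)] \<nu> by (simp add: I_def F(2))
qed

text \<open>
  The whole sequence is measurable with respect to the \<open>\<sigma>\<close>-algebra generated by the countably many
  sets \<open>{f k > q}\<close> with rational \<open>q\<close>, so a subsequence converges setwise on it. Against functions
  measurable for this \<open>\<sigma>\<close>-algebra, an arbitrary bounded \<open>\<phi>\<close> integrates like its conditional
  expectation.
\<close>

lemma (in finite_measure) weakly_convergent_subsequence:
  fixes f :: "nat \<Rightarrow> 'a \<Rightarrow> real"
  assumes f: "\<And>k. integrable M (f k)" "\<And>k x. 0 \<le> f k x"
    and B: "\<And>k. (\<integral>x. f k x \<partial>M) \<le> B"
    and ui: "\<And>\<epsilon>. 0 < \<epsilon> \<Longrightarrow>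
      \<exists>\<delta>>0. \<forall>A\<in>sets M. measure M A < \<delta> \<longrightarrow> (\<forall>k. (LINT x:A|M. f k x) < \<epsilon>)"
  obtains r F where "strict_mono (r :: nat \<Rightarrow> nat)" "integrable M F"
    "\<And>\<phi> C. \<phi> \<in> borel_measurable M \<Longrightarrow> (\<And>x. \<bar>\<phi> x\<bar> \<le> C) \<Longrightarrow>
      (\<lambda>k. \<integral>x. f (r k) x * \<phi> x \<partial>M) \<longlonglongrightarrow> (\<integral>x. F x * \<phi> x \<partial>M)"
proof -
  have f_meas [measurable]: "f k \<in> borel_measurable M" for k
    using f(1) by auto
  \<comment> \<open>Finite intersections of the generating sets; the empty index set yields the whole space.\<close>
  define E where "E J = {x \<in> space M. \<forall>p\<in>J. real_of_rat (snd p) < f (fst p) x}" for J :: "(nat \<times> rat) set"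
  define C where "C = E ` {J. finite J}"
  have C_sets: "C \<subseteq> sets M"
    unfolding C_def E_def by auto
  have C_Pow: "C \<subseteq> Pow (space M)"
    by (auto simp: C_def E_def)
  define G where "G = sigma (space M) C"
  have space_G [simp]: "space G = space M" and sets_G: "sets G = sigma_sets (space M) C"
    unfolding G_def using C_Pow by (simp_all add: space_measure_of_conv)
  have sub: "subalgebra M G"
    unfolding subalgebra_def using C_sets by (auto simp: sets_G intro: sets.sigma_sets_subset[THEN subsetD])
  have f_G [measurable]: "f k \<in> borel_measurable G" for k
  proof (subst borel_measurable_iff_greater, rule allI)
    fix a
    have "{w \<in> space G. a < f k w} = (\<Union>q\<in>{q. a \<le> real_of_rat q}. E {(k, q)})"
    proof (intro equalityI subsetI)
      fix x assume x: "x \<in> {w \<in> space G. a < f k w}"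
      then obtain q where "a < real_of_rat q" "real_of_rat q < f k x"
        using of_rat_dense by blast
      then show "x \<in> (\<Union>q\<in>{q. a \<le> real_of_rat q}. E {(k, q)})"
        using x by (auto simp: E_def intro!: exI[of _ q])
    qed (auto simp: E_def)
    moreover have "E {(k, q)} \<in> sets G" for q
      unfolding sets_G by (rule sigma_sets.Basic) (simp add: C_def)
    ultimately show "{w \<in> space G. a < f k w} \<in> sets G"
      by (auto intro!: sets.countable_UN')
  qed
  define R where "R = restr_to_subalg M G"
  have sets_R: "sets R = sets G" and space_R: "space R = space M"
    unfolding R_def using sub by (simp_all add: sets_restr_to_subalg space_restr_to_subalg)
  interpret R: finite_measure R
    unfolding R_def by (rule finite_measure_restr_to_subalg[OF sub finite_measure_axioms])
  interpret G: finite_measure_subalgebra M G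
    by unfold_locales (rule sub)
  have measure_R: "measure R A = measure M A" if "A \<in> sets G" for A
    unfolding R_def measure_def using that by (simp add: emeasure_restr_to_subalg[OF sub])
  have integral_R: "(\<integral>x. h x \<partial>R) = (\<integral>x. h x \<partial>M)" if "h \<in> borel_measurable G" for h :: "'a \<Rightarrow> real"
    unfolding R_def using integral_subalgebra2[OF sub that] .
  have f_R: "integrable R (f k)" for k
    unfolding R_def by (rule integrable_in_subalg[OF sub f_G f(1)])
  obtain r F where r: "strict_mono (r :: nat \<Rightarrow> nat)" and F: "integrable R F"
    and conv: "\<And>A. A \<in> sets R \<Longrightarrow> (\<lambda>k. LINT x:A|R. f (r k) x) \<longlonglongrightarrow> (LINT x:A|R. F x)"
  proof (rule R.setwise_convergent_subsequence[of C f B])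
    show "sets R = sigma_sets (space R) C"
      by (simp add: sets_R space_R sets_G)
    show "countable C"
      unfolding C_def by (intro countable_image countable_Collect_finite)
    have "E J \<inter> E J' = E (J \<union> J')" for J J'
      by (auto simp: E_def)
    then show "Int_stable C"
      by (auto simp: Int_stable_def C_def)
    show "C \<subseteq> Pow (space R)"
      using C_Pow by (simp add: space_R)
    have "E {} = space M"
      by (simp add: E_def)
    then show "space R \<in> C"
      unfolding C_def space_R by (metis finite.emptyI image_eqI mem_Collect_eq)
    show "(\<integral>x. f k x \<partial>R) \<le> B" for k
      using B by (simp add: integral_R)
    show "\<exists>\<delta>>0. \<forall>A\<in>sets R. measure R A < \<delta> \<longrightarrow> (\<forall>k. (LINT x:A|R. f k x) < e)" if "0 < e" for e
    proof -
      obtain d where d: "0 < d" "\<forall>A\<in>sets M. measure M A < d \<longrightarrow> (\<forall>k. (LINT x:A|M. f k x) < e)"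
        using ui[OF \<open>0 < e\<close>] by blast
      have "(LINT x:A|R. f k x) = (LINT x:A|M. f k x)" if [measurable]: "A \<in> sets G" for A k
        unfolding set_lebesgue_integral_def by (rule integral_R) measurable
      then show ?thesis
        using d sub by (intro exI[of _ d]) (auto simp: sets_R measure_R subalgebra_def)
    qed
  qed (use f_R f(2) in auto)
  have F_G [measurable]: "F \<in> borel_measurable G"
    using borel_measurable_integrable[OF F] by (simp add: measurable_cong_sets[OF sets_R refl])
  have F_M: "integrable M F"
    using integrable_from_subalg[OF sub] F by (simp add: R_def)
  define g where "g k x = f (r k) x - F x" for k x
  have g_G [measurable]: "g k \<in> borel_measurable G" for k
    unfolding g_def by measurable
  have g_R: "integrable R (g k)" and g_M: "integrable M (g k)" for k
    unfolding g_def using f_R F f(1) F_M by auto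
  have g_bound: "(\<integral>x. \<bar>g k x\<bar> \<partial>R) \<le> B + (\<integral>x. \<bar>F x\<bar> \<partial>R)" for k
  proof -
    have "(\<integral>x. \<bar>g k x\<bar> \<partial>R) \<le> (\<integral>x. f (r k) x + \<bar>F x\<bar> \<partial>R)"
    proof (rule integral_mono)
      show "\<bar>g k x\<bar> \<le> f (r k) x + \<bar>F x\<bar>" for x
        using f(2)[of "r k" x] by (simp add: g_def)
    qed (use g_R f_R F in auto)
    also have "\<dots> = (\<integral>x. f (r k) x \<partial>R) + (\<integral>x. \<bar>F x\<bar> \<partial>R)"
      using f_R F by (intro Bochner_Integration.integral_add) auto
    finally show ?thesis
      using B[of "r k"] by (simp add: integral_R)
  qed
  have g_sets: "(\<lambda>k. LINT x:A|R. g k x) \<longlonglongrightarrow> 0" if A: "A \<in> sets R" for A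
  proof -
    have "(LINT x:A|R. g k x) = (LINT x:A|R. f (r k) x) - (LINT x:A|R. F x)" for k
      unfolding g_def using integrable_mult_indicator[OF A f_R] integrable_mult_indicator[OF A F]
      by (intro set_integral_diff) (auto simp: set_integrable_def)
    then show ?thesis
      using tendsto_diff[OF conv[OF A] tendsto_const[of "LINT x:A|R. F x"]] by simp
  qed
  have "(\<lambda>k. \<integral>x. f (r k) x * \<phi> x \<partial>M) \<longlonglongrightarrow> (\<integral>x. F x * \<phi> x \<partial>M)"
    if \<phi> [measurable]: "\<phi> \<in> borel_measurable M" and K: "\<And>x. \<bar>\<phi> x\<bar> \<le> K" for \<phi> K
  proof -
    have times_\<phi>: "integrable M (\<lambda>x. h x * \<phi> x)" if "integrable M h" for h :: "'a \<Rightarrow> real"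
    proof (rule Bochner_Integration.integrable_bound[OF integrable_mult_right[OF that, of K]])
      show "AE x in M. norm (h x * \<phi> x) \<le> norm (K * h x)"
        using order.trans[OF K abs_ge_self] by (intro AE_I2) (simp add: abs_mult mult.commute[of "\<bar>h _\<bar>"] mult_right_mono)
    qed (use that in auto)
    have \<phi>_int: "integrable M \<phi>"
      by (rule integrable_const_bound[of _ K]) (use K in auto)
    define e where "e = real_cond_exp M G \<phi>"
    \<comment> \<open>The conditional expectation obeys the bound \<open>K\<close> only almost everywhere; clamping makes it bounded everywhere.\<close>
    define e' where "e' x = max (- K) (min K (e x))" for x
    have e_G [measurable]: "e \<in> borel_measurable G"
      unfolding e_def by measurable
    have e'_G [measurable]: "e' \<in> borel_measurable G"
      unfolding e'_def by measurable
    have "0 \<le> K"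
      using K[of undefined] by linarith
    have const: "AE x in M. real_cond_exp M G (\<lambda>x. c) x = c" for c
      by (rule G.real_cond_exp_F_meas) auto
    have "AE x in M. real_cond_exp M G \<phi> x \<le> real_cond_exp M G (\<lambda>x. K) x"
      using K by (intro G.real_cond_exp_mono \<phi>_int AE_I2) (auto simp: abs_le_iff)
    moreover have "AE x in M. real_cond_exp M G (\<lambda>x. - K) x \<le> real_cond_exp M G \<phi> x"
      using K by (intro G.real_cond_exp_mono \<phi>_int AE_I2) (auto simp: abs_le_iff minus_le_iff)
    ultimately have e_e': "AE x in M. e x = e' x"
      using const[of K] const[of "- K"] by eventually_elim (simp add: e_def e'_def)
    have "(\<lambda>k. \<integral>x. g k x * e' x \<partial>R) \<longlonglongrightarrow> 0"
      by (rule integral_times_bounded_tendsto_0[OF g_R g_bound g_sets, of e' K])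
        (use e'_G \<open>0 \<le> K\<close> in \<open>auto simp: e'_def measurable_cong_sets[OF sets_R refl]\<close>)
    moreover have "(\<integral>x. g k x * e' x \<partial>R) = (\<integral>x. f (r k) x * \<phi> x \<partial>M) - (\<integral>x. F x * \<phi> x \<partial>M)" for k
    proof -
      have [measurable]: "e \<in> borel_measurable M" "e' \<in> borel_measurable M" "g k \<in> borel_measurable M"
        by (rule measurable_from_subalg[OF sub], measurable)+
      have "(\<integral>x. g k x * e' x \<partial>R) = (\<integral>x. g k x * e' x \<partial>M)"
        by (rule integral_R) measurable
      also have "\<dots> = (\<integral>x. g k x * e x \<partial>M)"
        using e_e' by (intro integral_cong_AE) auto
      also have "\<dots> = (\<integral>x. g k x * \<phi> x \<partial>M)"
        unfolding e_def by (rule G.real_cond_exp_intg(2)) (use times_\<phi>[OF g_M] in auto)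
      also have "\<dots> = (\<integral>x. f (r k) x * \<phi> x \<partial>M) - (\<integral>x. F x * \<phi> x \<partial>M)"
        unfolding g_def left_diff_distrib using times_\<phi> f(1) F_M by (intro Bochner_Integration.integral_diff) auto
      finally show ?thesis .
    qed
    ultimately show ?thesis
      using LIM_zero_cancel by fastforce
  qed
  then show ?thesis
    using that[OF r F_M] by blast
qed

section \<open>Bounded functionals on the space of integrable functions\<close>

lemma L1_add_class:
  assumes "integrable M f" "integrable M g"
  shows "L1_add M (L1_class M f) (L1_class M g) = L1_class M (\<lambda>x. f x + g x)"
proof -
  have "AE x in M. L1_rep (L1_class M f) x + L1_rep (L1_class M g) x = f x + g x"
    using L1_rep_class(2)[OF assms(1)] L1_rep_class(2)[OF assms(2)] by eventually_elim simp
  then show ?thesis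
    unfolding L1_add_def using assms L1_rep_class(1) by (subst L1_class_eq_iff) auto
qed

lemma L1_scale_class:
  assumes "integrable M f"
  shows "L1_scale M c (L1_class M f) = L1_class M (\<lambda>x. c * f x)"
proof -
  have "AE x in M. c * L1_rep (L1_class M f) x = c * f x"
    using L1_rep_class(2)[OF assms] by eventually_elim simp
  then show ?thesis
    unfolding L1_scale_def using assms L1_rep_class(1) by (subst L1_class_eq_iff) auto
qed

lemma L1_norm_class:
  assumes "integrable M f"
  shows "L1_norm M (L1_class M f) = (\<integral>x. \<bar>f x\<bar> \<partial>M)"
  unfolding L1_norm_def
proof (rule integral_cong_AE)
  show "AE x in M. \<bar>L1_rep (L1_class M f) x\<bar> = \<bar>f x\<bar>"
    using L1_rep_class(2)[OF assms] by eventually_elim simp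
qed (use assms L1_rep_class(1)[OF assms] in auto)

text \<open>
  The dual of \<open>L\<^sup>1\<close> is \<open>L\<^sup>\<infinity>\<close>. If \<open>\<psi>\<close> has norm at most \<open>C\<close>, then \<open>\<psi> + C \<integral>\<close> is a positive
  functional, and this shift replaces a Jordan decomposition: its values on indicator functions
  have a density \<open>f\<close> with \<open>0 \<le> f \<le> 2 C\<close> almost everywhere, and \<open>f - C\<close> represents \<open>\<psi>\<close> on indicators,
  hence by continuity on all integrable functions.
\<close>

lemma (in finite_measure) L1_functional_bounded_density:
  assumes \<psi>: "L1_bounded_linear_functional M \<psi>"
  obtains k C where "k \<in> borel_measurable M" "\<And>x. \<bar>k x\<bar> \<le> C"
    "\<And>F. F \<in> L1 M \<Longrightarrow> \<psi> F = (\<integral>x. L1_rep F x * k x \<partial>M)"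
proof -
  define \<Psi> where "\<Psi> f = \<psi> (L1_class M f)" for f
  have \<Psi>_add: "\<Psi> (\<lambda>x. f x + g x) = \<Psi> f + \<Psi> g" if "integrable M f" "integrable M g" for f g
    unfolding \<Psi>_def L1_add_class[OF that, symmetric]
    using \<psi> that by (simp add: L1_bounded_linear_functional_def L1_class_in_L1)
  have scale: "\<Psi> (\<lambda>x. c * f x) = c * \<Psi> f" if "integrable M f" for c f
    unfolding \<Psi>_def L1_scale_class[OF that, symmetric]
    using \<psi> that by (simp add: L1_bounded_linear_functional_def L1_class_in_L1)
  obtain C0 where C0: "\<And>F. F \<in> L1 M \<Longrightarrow> \<bar>\<psi> F\<bar> \<le> C0 * L1_norm M F"
    using \<psi> unfolding L1_bounded_linear_functional_def by blast
  define C where "C = \<bar>C0\<bar>"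
  have "0 \<le> C"
    by (simp add: C_def)
  have bound: "\<bar>\<Psi> f\<bar> \<le> C * (\<integral>x. \<bar>f x\<bar> \<partial>M)" if "integrable M f" for f
  proof -
    have "\<bar>\<Psi> f\<bar> \<le> C0 * (\<integral>x. \<bar>f x\<bar> \<partial>M)"
      unfolding \<Psi>_def L1_norm_class[OF that, symmetric] using that by (intro C0 L1_class_in_L1)
    also have "\<dots> \<le> C * (\<integral>x. \<bar>f x\<bar> \<partial>M)"
      by (intro mult_right_mono) (auto simp: C_def)
    finally show ?thesis .
  qed
  have ind: "integrable M (indicator A :: 'a \<Rightarrow> real)" if "A \<in> sets M" for A
    using that by (intro integrable_real_indicator) (simp_all add: emeasure_eq_measure)
  have \<Psi>_ind: "\<bar>\<Psi> (indicator A)\<bar> \<le> C * measure M A" if "A \<in> sets M" for A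
    using bound[OF ind[OF that]] that by simp
  define \<nu> where "\<nu> A = \<Psi> (indicator A) + C * measure M A" for A
  have \<nu>_le: "\<nu> A \<le> 2 * C * measure M A" if "A \<in> sets M" for A
    using \<Psi>_ind[OF that] by (simp add: \<nu>_def abs_le_iff)
  obtain f where f: "f \<in> borel_measurable M" "\<And>x. 0 \<le> f x" "integrable M f"
    "\<And>A. A \<in> sets M \<Longrightarrow> \<nu> A = (LINT x:A|M. f x)"
  proof (rule absolutely_continuous_set_function_has_density[of \<nu>])
    show "0 \<le> \<nu> A" if "A \<in> sets M" for A
      using \<Psi>_ind[OF that] by (simp add: \<nu>_def abs_le_iff)
    show "\<nu> (A \<union> B) = \<nu> A + \<nu> B" if "A \<in> sets M" "B \<in> sets M" "A \<inter> B = {}" for A B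
    proof -
      have "indicator (A \<union> B) = (\<lambda>x. indicator A x + indicator B x :: real)"
        using that(3) by (auto simp: indicator_def fun_eq_iff)
      then show ?thesis
        using \<Psi>_add[OF ind[OF that(1)] ind[OF that(2)]] that
        by (simp add: \<nu>_def finite_measure_Union algebra_simps)
    qed
    show "\<exists>\<delta>>0. \<forall>A\<in>sets M. measure M A < \<delta> \<longrightarrow> \<nu> A < e" if "0 < e" for e
    proof (intro exI conjI ballI impI)
      show "0 < e / (2 * C + 1)"
        using that \<open>0 \<le> C\<close> by simp
      fix A assume A: "A \<in> sets M" "measure M A < e / (2 * C + 1)"
      have "\<nu> A \<le> (2 * C + 1) * measure M A"
        using \<nu>_le[OF A(1)] by (simp add: algebra_simps add_increasing)
      also have "\<dots> < e"
        using A(2) \<open>0 \<le> C\<close> by (simp add: pos_less_divide_eq mult.commute)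
      finally show "\<nu> A < e" .
    qed
  qed blast
  have f_set: "set_integrable M A f" if "A \<in> sets M" for A
    unfolding set_integrable_def using integrable_mult_indicator[OF that f(3)] .
  have "AE x in M. 0 \<le> 2 * C - f x"
  proof (rule density_nonneg)
    fix A assume A: "A \<in> sets M"
    have "(LINT x:A|M. 2 * C - f x) = (LINT x:A|M. 2 * C) - (LINT x:A|M. f x)"
      using f_set[OF A] integrable_mult_indicator[OF A integrable_const[of "2 * C"]]
      by (intro set_integral_diff) (simp_all only: set_integrable_def)
    moreover have "(LINT x:A|M. 2 * C) = 2 * C * measure M A"
      using A by (simp add: set_lebesgue_integral_def)
    ultimately show "0 \<le> (LINT x:A|M. 2 * C - f x)"
      using \<nu>_le[OF A] f(4)[OF A] by linarith
  qed (use f in auto)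
  \<comment> \<open>Truncation changes \<open>f\<close> only on a null set and makes the bound hold everywhere.\<close>
  define k where "k x = min (2 * C) (f x) - C" for x
  have k [measurable]: "k \<in> borel_measurable M"
    unfolding k_def using f(1) by measurable
  have k_le: "\<bar>k x\<bar> \<le> C" for x
    using f(2)[of x] \<open>0 \<le> C\<close> by (auto simp: k_def abs_le_iff)
  have times_k: "integrable M (\<lambda>x. g x * k x)" if "integrable M g" for g :: "'a \<Rightarrow> real"
  proof (rule Bochner_Integration.integrable_bound[OF integrable_mult_right[OF that, of C]])
    show "AE x in M. norm (g x * k x) \<le> norm (C * g x)"
      using order.trans[OF k_le abs_ge_self]
      by (intro AE_I2) (simp add: abs_mult mult.commute[of "\<bar>g _\<bar>"] mult_right_mono)
  qed (use that in auto)
  have k_ind: "\<Psi> (indicator A) = (\<integral>x. indicator A x * k x \<partial>M)" if A: "A \<in> sets M" for A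
  proof -
    have "(\<integral>x. indicator A x * k x \<partial>M) = (\<integral>x. indicator A x * f x - C * indicator A x \<partial>M)"
    proof (rule integral_cong_AE)
      show "AE x in M. indicator A x * k x = indicator A x * f x - C * indicator A x"
        using \<open>AE x in M. 0 \<le> 2 * C - f x\<close> by eventually_elim (simp add: k_def algebra_simps)
    qed (use A f(1) in auto)
    also have "\<dots> = (\<integral>x. indicator A x * f x \<partial>M) - (\<integral>x. C * indicator A x \<partial>M)"
    proof (rule Bochner_Integration.integral_diff)
      show "integrable M (\<lambda>x. indicator A x * f x)"
        using f_set[OF A] by (simp add: set_integrable_def)
    qed (rule integrable_mult_right[OF ind[OF A]])
    also have "\<dots> = (LINT x:A|M. f x) - C * measure M A"
      using A by (simp add: set_lebesgue_integral_def)
    finally show ?thesis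
      using f(4)[OF A] by (simp add: \<nu>_def)
  qed
  have rep: "\<Psi> g = (\<integral>x. g x * k x \<partial>M)" if "integrable M g" for g
    using that
  proof (induction rule: integrable_induct)
    case (base A c)
    then show ?case
      using scale[OF ind[OF base(1)], of c] k_ind[OF base(1)] times_k[OF ind[OF base(1)]]
      by (simp add: mult.commute[of _ c] mult.assoc)
  next
    case (add g g')
    then show ?case
      using times_k by (simp add: \<Psi>_add distrib_right)
  next
    case (lim g s)
    have meas [measurable]: "g \<in> borel_measurable M" "s i \<in> borel_measurable M" for i
      using lim by auto
    have "(\<lambda>i. \<integral>x. \<bar>s i x - g x\<bar> \<partial>M) \<longlonglongrightarrow> (\<integral>x. 0 \<partial>M)"
    proof (rule integral_dominated_convergence)
      show "integrable M (\<lambda>x. 3 * \<bar>g x\<bar>)"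
        using lim by auto
      show "AE x in M. (\<lambda>i. \<bar>s i x - g x\<bar>) \<longlonglongrightarrow> 0"
        using lim by (intro AE_I2 tendsto_rabs_zero LIM_zero) auto
      show "AE x in M. norm \<bar>s i x - g x\<bar> \<le> 3 * \<bar>g x\<bar>" for i
      proof (rule AE_I2)
        fix x assume "x \<in> space M"
        then have "\<bar>s i x\<bar> \<le> 2 * \<bar>g x\<bar>"
          using lim.hyps(3)[of x i] by simp
        then show "norm \<bar>s i x - g x\<bar> \<le> 3 * \<bar>g x\<bar>"
          unfolding real_norm_def by linarith
      qed
    qed auto
    then have L1_conv: "(\<lambda>i. C * (\<integral>x. \<bar>s i x - g x\<bar> \<partial>M)) \<longlonglongrightarrow> 0"
      using tendsto_mult_right_zero by fastforce
    have diff: "\<Psi> (\<lambda>x. s i x - g x) = \<Psi> (s i) - \<Psi> g" for i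
      using \<Psi>_add[of "s i" "\<lambda>x. - 1 * g x"] scale[of g "- 1"] lim by simp
    have "(\<lambda>i. \<Psi> (s i) - \<Psi> g) \<longlonglongrightarrow> 0"
      using L1_conv
    proof (rule Lim_null_comparison[rotated], intro always_eventually allI)
      fix i show "norm (\<Psi> (s i) - \<Psi> g) \<le> C * (\<integral>x. \<bar>s i x - g x\<bar> \<partial>M)"
        using bound[of "\<lambda>x. s i x - g x"] lim by (simp add: diff)
    qed
    then have "(\<lambda>i. \<Psi> (s i)) \<longlonglongrightarrow> \<Psi> g"
      by (rule LIM_zero_cancel)
    moreover have "(\<lambda>i. (\<integral>x. s i x * k x \<partial>M) - (\<integral>x. g x * k x \<partial>M)) \<longlonglongrightarrow> 0"
      using L1_conv
    proof (rule Lim_null_comparison[rotated], intro always_eventually allI)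
      fix i
      have "norm ((\<integral>x. s i x * k x \<partial>M) - (\<integral>x. g x * k x \<partial>M)) = \<bar>\<integral>x. s i x * k x - g x * k x \<partial>M\<bar>"
        using lim times_k by simp
      also have "\<dots> \<le> (\<integral>x. \<bar>s i x * k x - g x * k x\<bar> \<partial>M)"
        by (rule integral_abs_bound)
      also have "\<dots> \<le> (\<integral>x. C * \<bar>s i x - g x\<bar> \<partial>M)"
      proof (rule integral_mono)
        show "\<bar>s i x * k x - g x * k x\<bar> \<le> C * \<bar>s i x - g x\<bar>" for x
          unfolding left_diff_distrib[symmetric] abs_mult
          using k_le[of x] by (simp add: mult.commute[of C] mult_left_mono)
      qed (use lim times_k in auto)
      finally show "norm ((\<integral>x. s i x * k x \<partial>M) - (\<integral>x. g x * k x \<partial>M)) \<le> C * (\<integral>x. \<bar>s i x - g x\<bar> \<partial>M)"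
        by simp
    qed
    then have "(\<lambda>i. \<Psi> (s i)) \<longlonglongrightarrow> (\<integral>x. g x * k x \<partial>M)"
      unfolding lim.IH by (rule LIM_zero_cancel)
    ultimately show ?case
      by (rule LIMSEQ_unique)
  qed
  have "\<psi> F = (\<integral>x. L1_rep F x * k x \<partial>M)" if "F \<in> L1 M" for F
    using rep[OF L1_rep_integrable[OF that]] by (simp add: \<Psi>_def L1_class_rep[OF that])
  then show ?thesis
    using that k k_le by blast
qed

text \<open>
  The sufficiency half of the Dunford--Pettis theorem. The norm bound cannot be dropped: on an atom
  uniform integrability alone does not bound the values.
\<close>

lemma (in finite_measure) uniformly_integrable_imp_weakly_precompact:
  assumes S: "S \<subseteq> L1_pos M"
    and B: "\<And>F. F \<in> S \<Longrightarrow> L1_norm M F \<le> B"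
    and ui: "L1_uniformly_integrable M S"
  shows "L1_weakly_precompact M S"
  unfolding L1_weakly_precompact_def
proof (intro conjI allI impI)
  show L1: "S \<subseteq> L1 M"
    using S by (auto simp: L1_pos_def)
  fix u :: "nat \<Rightarrow> ('a \<Rightarrow> real) set"
  assume u: "\<forall>k. u k \<in> S"
  then have u_L1: "u k \<in> L1 M" for k
    using L1 by blast
  \<comment> \<open>Representatives of positive elements may be negative on a null set.\<close>
  define f where "f k x = max 0 (L1_rep (u k) x)" for k x
  have u_int [measurable]: "integrable M (L1_rep (u k))" for k
    using u_L1 by (rule L1_rep_integrable)
  have f_int: "integrable M (f k)" for k
    unfolding f_def using u_int by auto
  have f_AE: "AE x in M. f k x = L1_rep (u k) x" for k
  proof -
    have "AE x in M. 0 \<le> L1_rep (u k) x"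
      using u S by (auto simp: L1_pos_def)
    then show ?thesis
      by eventually_elim (simp add: f_def)
  qed
  obtain r F where r: "strict_mono (r :: nat \<Rightarrow> nat)" and F: "integrable M F"
    and conv: "\<And>\<phi> C. \<phi> \<in> borel_measurable M \<Longrightarrow> (\<And>x. \<bar>\<phi> x\<bar> \<le> C) \<Longrightarrow>
      (\<lambda>k. \<integral>x. f (r k) x * \<phi> x \<partial>M) \<longlonglongrightarrow> (\<integral>x. F x * \<phi> x \<partial>M)"
  proof (rule weakly_convergent_subsequence[of f B])
    show "0 \<le> f k x" for k x
      by (simp add: f_def)
    show "(\<integral>x. f k x \<partial>M) \<le> B" for k
    proof -
      have "(\<integral>x. f k x \<partial>M) \<le> (\<integral>x. \<bar>L1_rep (u k) x\<bar> \<partial>M)"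
        using f_int u_int by (intro integral_mono) (auto simp: f_def)
      also have "\<dots> \<le> B"
        using B[of "u k"] u by (simp add: L1_norm_def)
      finally show ?thesis .
    qed
    show "\<exists>\<delta>>0. \<forall>A\<in>sets M. measure M A < \<delta> \<longrightarrow> (\<forall>k. (LINT x:A|M. f k x) < e)" if "0 < e" for e
    proof -
      have "(LINT x:A|M. f k x) = (LINT x:A|M. L1_rep (u k) x)" if "A \<in> sets M" for A k
        unfolding set_lebesgue_integral_def
      proof (rule integral_cong_AE)
        show "AE x in M. indicator A x *\<^sub>R f k x = indicator A x *\<^sub>R L1_rep (u k) x"
          using f_AE[of k] by eventually_elim simp
      qed (use that f_int[of k] u_int[of k] in auto)
      then show ?thesis
        using ui u \<open>0 < e\<close> unfolding L1_uniformly_integrable_def by metis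
    qed
  qed (use f_int in blast)+
  have "L1_weak_tendsto M (u \<circ> r) (L1_class M F)"
    unfolding L1_weak_tendsto_def
  proof (intro allI impI)
    fix \<psi> assume "L1_bounded_linear_functional M \<psi>"
    then obtain k C where k [measurable]: "k \<in> borel_measurable M" and C: "\<And>x. \<bar>k x\<bar> \<le> C"
      and \<psi>: "\<And>F. F \<in> L1 M \<Longrightarrow> \<psi> F = (\<integral>x. L1_rep F x * k x \<partial>M)"
      using L1_functional_bounded_density by blast
    have "\<psi> ((u \<circ> r) i) = (\<integral>x. f (r i) x * k x \<partial>M)" for i
      unfolding o_def \<psi>[OF u_L1]
    proof (rule integral_cong_AE)
      show "AE x in M. L1_rep (u (r i)) x * k x = f (r i) x * k x"
        using f_AE[of "r i"] by eventually_elim simp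
    qed (use f_int[of "r i"] u_int[of "r i"] in auto)
    moreover have "\<psi> (L1_class M F) = (\<integral>x. F x * k x \<partial>M)"
      unfolding \<psi>[OF L1_class_in_L1[OF F]]
    proof (rule integral_cong_AE)
      show "AE x in M. L1_rep (L1_class M F) x * k x = F x * k x"
        using L1_rep_class(2)[OF F] by eventually_elim simp
    qed (use F L1_rep_class(1)[OF F] in auto)
    ultimately show "(\<lambda>i. \<psi> ((u \<circ> r) i)) \<longlonglongrightarrow> \<psi> (L1_class M F)"
      using conv[OF k C] by simp
  qed
  then show "\<exists>r. strict_mono (r :: nat \<Rightarrow> nat) \<and> (\<exists>F\<in>L1 M. L1_weak_tendsto M (u \<circ> r) F)"
    using r L1_class_in_L1[OF F] by blast
qed

section \<open>Images of a function under Markov operators\<close>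

lemma integral_excess_tendsto_0:
  fixes f :: "'a \<Rightarrow> real"
  assumes f [measurable]: "integrable M f"
  shows "(\<lambda>n. \<integral>x. max 0 (f x - real n) \<partial>M) \<longlonglongrightarrow> 0"
proof -
  have "(\<lambda>n. \<integral>x. max 0 (f x - real n) \<partial>M) \<longlonglongrightarrow> (\<integral>x. 0 \<partial>M)"
  proof (rule integral_dominated_convergence)
    show "integrable M (\<lambda>x. \<bar>f x\<bar>)"
      using f by auto
    show "AE x in M. (\<lambda>n. max 0 (f x - real n)) \<longlonglongrightarrow> 0"
    proof (rule AE_I2)
      fix x
      have "max 0 (f x - real n) = 0" if "n \<ge> nat \<lceil>f x\<rceil>" for n
        using that by (simp add: nat_ceiling_le_eq)
      then show "(\<lambda>n. max 0 (f x - real n)) \<longlonglongrightarrow> 0"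
        by (intro tendsto_eventually eventually_sequentiallyI[of "nat \<lceil>f x\<rceil>"])
    qed
  qed auto
  then show ?thesis
    by simp
qed

lemma (in finite_measure) integrable_small_on_small_sets:
  fixes f :: "'a \<Rightarrow> real"
  assumes f [measurable]: "integrable M f" and "0 < \<epsilon>"
  obtains \<delta> where "0 < \<delta>" "\<And>A. A \<in> sets M \<Longrightarrow> measure M A < \<delta> \<Longrightarrow> (LINT x:A|M. f x) < \<epsilon>"
proof -
  obtain n where n: "(\<integral>x. max 0 (f x - real n) \<partial>M) < \<epsilon> / 2"
    using LIMSEQ_D[OF integral_excess_tendsto_0[OF f], of "\<epsilon> / 2"] \<open>0 < \<epsilon>\<close> by auto
  have "(LINT x:A|M. f x) < \<epsilon>" if A: "A \<in> sets M" "measure M A < \<epsilon> / (2 * (real n + 1))" for A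
  proof -
    have ind: "integrable M (indicator A :: 'a \<Rightarrow> real)"
      using A(1) by (intro integrable_real_indicator) (simp_all add: emeasure_eq_measure)
    have "(LINT x:A|M. f x) \<le> (\<integral>x. max 0 (f x - real n) + real n * indicator A x \<partial>M)"
      unfolding set_lebesgue_integral_def
    proof (rule integral_mono)
      show "indicator A x *\<^sub>R f x \<le> max 0 (f x - real n) + real n * indicator A x" for x
        by (simp add: indicator_def max_def)
    qed (use A f ind integrable_mult_indicator[OF A(1) f] in auto)
    also have "\<dots> = (\<integral>x. max 0 (f x - real n) \<partial>M) + real n * measure M A"
      using A f ind by (subst Bochner_Integration.integral_add) auto
    also have "real n * measure M A \<le> \<epsilon> / 2"
    proof -
      have "real n * measure M A \<le> (real n + 1) * measure M A"
        by (simp add: algebra_simps)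
      also have "\<dots> \<le> \<epsilon> / 2"
        using A(2) by (simp add: pos_less_divide_eq algebra_simps)
      finally show ?thesis .
    qed
    finally show ?thesis
      using n by linarith
  qed
  moreover have "0 < \<epsilon> / (2 * (real n + 1))"
    using \<open>0 < \<epsilon>\<close> by simp
  ultimately show ?thesis
    using that by blast
qed

text \<open>
  The bound \<open>Q G \<le> c Q H + Q ((G - c H)\<^sup>+)\<close> integrated over \<open>A\<close>, where the last term is
  estimated by its integral over the whole space, which \<open>Q\<close> preserves. It results from applying
  \<open>Q\<close> to \<open>c H + (G - c H)\<^sup>+ = G + (c H - G)\<^sup>+\<close>, an identity in which only sums and multiples
  occur, and discarding the nonnegative \<open>Q ((c H - G)\<^sup>+)\<close>.
\<close>

lemma markov_operator_set_integral_le: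
  assumes Q: "markov_operator M Q" and G: "G \<in> L1 M" and H: "H \<in> L1 M" and A: "A \<in> sets M"
  shows "(LINT x:A|M. L1_rep (Q G) x)
    \<le> c * (LINT x:A|M. L1_rep (Q H) x) + (\<integral>x. max 0 (L1_rep G x - c * L1_rep H x) \<partial>M)"
proof -
  define excess where "excess x = max 0 (L1_rep G x - c * L1_rep H x)" for x
  define gap where "gap x = max 0 (c * L1_rep H x - L1_rep G x)" for x
  define E where "E = L1_class M excess"
  define D where "D = L1_class M gap"
  have G_int: "integrable M (L1_rep G)" and H_int: "integrable M (L1_rep H)"
    using G H by (auto intro: L1_rep_integrable)
  have excess: "integrable M excess" and gap: "integrable M gap"
    unfolding excess_def gap_def using G_int H_int by auto
  have pos: "L1_class M f \<in> L1_pos M" if "integrable M f" "\<And>x. 0 \<le> f x" for f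
    using L1_rep_class(2)[OF that(1)] that by (auto simp: L1_pos_def L1_class_in_L1)
  have E_pos: "E \<in> L1_pos M" and D_pos: "D \<in> L1_pos M"
    unfolding E_def D_def using excess gap by (auto intro!: pos simp: excess_def gap_def)
  then have E_L1: "E \<in> L1 M" and D_L1: "D \<in> L1 M"
    by (auto simp: L1_pos_def)
  have "L1_add M (L1_scale M c H) E = L1_add M G D"
  proof -
    have "L1_add M (L1_scale M c (L1_class M (L1_rep H))) E
        = L1_class M (\<lambda>x. c * L1_rep H x + excess x)"
      unfolding E_def L1_scale_class[OF H_int] using H_int excess by (intro L1_add_class) auto
    moreover have "L1_add M (L1_class M (L1_rep G)) D = L1_class M (\<lambda>x. L1_rep G x + gap x)"
      unfolding D_def using G_int gap by (intro L1_add_class) auto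
    moreover have "c * L1_rep H x + excess x = L1_rep G x + gap x" for x
      by (simp add: excess_def gap_def)
    ultimately show ?thesis
      by (simp add: L1_class_rep[OF G] L1_class_rep[OF H])
  qed
  then have Q_eq: "L1_add M (L1_scale M c (Q H)) (Q E) = L1_add M (Q G) (Q D)"
    using Q E_L1 D_L1 G H unfolding markov_operator_def
    by (metis H_int L1_class_in_L1 L1_class_rep L1_scale_class integrable_mult_right)
  have Q_L1: "Q F \<in> L1 M" if "F \<in> L1 M" for F
    using Q that by (simp add: markov_operator_def)
  note Q_int = L1_rep_integrable[OF Q_L1[OF G]] L1_rep_integrable[OF Q_L1[OF H]]
    L1_rep_integrable[OF Q_L1[OF E_L1]] L1_rep_integrable[OF Q_L1[OF D_L1]]
  have "L1_class M (\<lambda>x. c * L1_rep (Q H) x + L1_rep (Q E) x)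
      = L1_class M (\<lambda>x. L1_rep (Q G) x + L1_rep (Q D) x)"
  proof -
    have "L1_add M (L1_scale M c (Q H)) (Q E) = L1_class M (\<lambda>x. c * L1_rep (Q H) x + L1_rep (Q E) x)"
      using L1_add_class[of M "\<lambda>x. c * L1_rep (Q H) x" "L1_rep (Q E)"] Q_int
      by (simp add: L1_scale_def L1_class_rep Q_L1 E_L1)
    then show ?thesis
      using Q_eq by (simp add: L1_add_def)
  qed
  then have "AE x in M. c * L1_rep (Q H) x + L1_rep (Q E) x = L1_rep (Q G) x + L1_rep (Q D) x"
    using Q_int by (subst (asm) L1_class_eq_iff) auto
  moreover have QD_pos: "AE x in M. 0 \<le> L1_rep (Q D) x" and QE_pos: "AE x in M. 0 \<le> L1_rep (Q E) x"
    using Q D_pos E_pos by (auto simp: markov_operator_def L1_pos_def)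
  ultimately have le: "AE x in M. L1_rep (Q G) x \<le> c * L1_rep (Q H) x + L1_rep (Q E) x"
    by eventually_elim simp
  have ind: "integrable M (\<lambda>x. indicator A x * f x)" if "integrable M f" for f :: "'a \<Rightarrow> real"
    using integrable_mult_indicator[OF A that] by simp
  have "(LINT x:A|M. L1_rep (Q G) x)
      \<le> (\<integral>x. c * (indicator A x * L1_rep (Q H) x) + L1_rep (Q E) x \<partial>M)"
    unfolding set_lebesgue_integral_def real_scaleR_def
  proof (rule integral_mono_AE)
    show "AE x in M. indicator A x * L1_rep (Q G) x
        \<le> c * (indicator A x * L1_rep (Q H) x) + L1_rep (Q E) x"
      using le QE_pos by eventually_elim (simp add: indicator_def)
  qed (use ind Q_int in auto)
  also have "\<dots> = c * (LINT x:A|M. L1_rep (Q H) x) + L1_integral M (Q E)"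
    unfolding set_lebesgue_integral_def real_scaleR_def L1_integral_def
    using ind Q_int by (subst Bochner_Integration.integral_add) auto
  also have "L1_integral M (Q E) = L1_integral M E"
    using Q E_L1 by (simp add: markov_operator_def)
  also have "\<dots> = (\<integral>x. excess x \<partial>M)"
    unfolding L1_integral_def E_def
    using L1_rep_class[OF excess] excess by (intro integral_cong_AE) auto
  finally show ?thesis
    by (simp add: excess_def)
qed

text \<open>
  Where \<open>h > \<alpha>\<close> the multiple \<open>(K / \<alpha>) h\<close> is at least \<open>K\<close>; elsewhere the excess over \<open>0\<close> is at most
  the excess over \<open>K\<close> plus \<open>K\<close>.
\<close>

lemma (in finite_measure) integral_excess_over_multiple_le:
  fixes g h :: "'a \<Rightarrow> real"
  assumes g: "integrable M g" and h: "integrable M h" and h_pos: "AE x in M. 0 \<le> h x"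
    and \<alpha>: "0 < \<alpha>" and K: "0 \<le> K"
  shows "(\<integral>x. max 0 (g x - K / \<alpha> * h x) \<partial>M)
    \<le> (\<integral>x. max 0 (g x - K) \<partial>M) + K * measure M {x \<in> space M. h x \<le> \<alpha>}"
proof -
  let ?L = "{x \<in> space M. h x \<le> \<alpha>}"
  have [measurable]: "g \<in> borel_measurable M" "h \<in> borel_measurable M"
    using g h by auto
  have L: "?L \<in> sets M"
    by measurable
  then have ind: "integrable M (indicator ?L :: 'a \<Rightarrow> real)"
    by (intro integrable_real_indicator) (simp_all add: emeasure_eq_measure)
  have "(\<integral>x. max 0 (g x - K / \<alpha> * h x) \<partial>M) \<le> (\<integral>x. max 0 (g x - K) + K * indicator ?L x \<partial>M)"
  proof (rule integral_mono_AE)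
    show "AE x in M. max 0 (g x - K / \<alpha> * h x) \<le> max 0 (g x - K) + K * indicator ?L x"
      using h_pos AE_space
    proof eventually_elim
      fix x assume x: "0 \<le> h x" "x \<in> space M"
      show "max 0 (g x - K / \<alpha> * h x) \<le> max 0 (g x - K) + K * indicator ?L x"
      proof (cases "h x \<le> \<alpha>")
        case True
        have "0 \<le> K / \<alpha> * h x"
          using x(1) \<alpha> K by simp
        moreover have "max 0 (g x - t) \<le> max 0 (g x - K) + K" if "0 \<le> t" for t
          using that K by (auto simp: max_def)
        ultimately show ?thesis
          using x True by simp
      next
        case False
        then have "K * \<alpha> \<le> K * h x"
          using K by (intro mult_left_mono) auto
        then have "K \<le> K / \<alpha> * h x"
          using \<alpha> by (simp add: field_simps)
        then show ?thesis
          using False by (auto simp: max_def)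
      qed
    qed
  qed (use g h ind in auto)
  also have "\<dots> = (\<integral>x. max 0 (g x - K) \<partial>M) + K * measure M ?L"
    using g L ind by (subst Bochner_Integration.integral_add) auto
  finally show ?thesis .
qed

text \<open>
  The common image \<open>H0\<close> of the functions \<open>H i\<close> dominates the images of \<open>G\<close> up to a multiple and
  a uniformly small remainder. The constants are chosen in the order \<open>K\<close>, \<open>\<eta>\<close>, \<open>\<alpha>\<close>, \<open>c\<close>,
  \<open>\<delta>\<close>, and the three contributions
  \<open>\<integral> (G - K)\<^sup>+\<close>, \<open>K m {H i \<le> \<alpha>}\<close> and \<open>c \<integral>\<^sub>A H0\<close> are each at most \<open>\<epsilon> / 3\<close>.
\<close>

lemma (in prob_space) markov_images_uniformly_integrable:
  fixes Q :: "'i \<Rightarrow> ('a \<Rightarrow> real) set \<Rightarrow> ('a \<Rightarrow> real) set"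
  assumes Q: "\<And>i. i \<in> I \<Longrightarrow> markov_operator M (Q i)"
    and H: "\<And>i. i \<in> I \<Longrightarrow> H i \<in> L1_pos M"
    and QH: "\<And>i. i \<in> I \<Longrightarrow> Q i (H i) = H0"
    and H0: "H0 \<in> L1 M"
    and large: "\<And>\<eta>. 0 < \<eta> \<Longrightarrow>
      \<exists>\<alpha>>0. \<forall>i\<in>I. 1 - \<eta> < measure M {x \<in> space M. L1_rep (H i) x > \<alpha>}"
    and G: "G \<in> L1 M"
  shows "L1_uniformly_integrable M {Q i G | i. i \<in> I}"
  unfolding L1_uniformly_integrable_def
proof (intro allI impI)
  fix \<epsilon> :: real assume "0 < \<epsilon>"
  have G_int: "integrable M (L1_rep G)" and H0_int: "integrable M (L1_rep H0)"
    using G H0 by (auto intro: L1_rep_integrable)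
  obtain K :: nat where K: "(\<integral>x. max 0 (L1_rep G x - real K) \<partial>M) < \<epsilon> / 3"
    using LIMSEQ_D[OF integral_excess_tendsto_0[OF G_int], of "\<epsilon> / 3"] \<open>0 < \<epsilon>\<close> by auto
  define \<eta> where "\<eta> = \<epsilon> / (3 * (real K + 1))"
  have "0 < \<eta>"
    using \<open>0 < \<epsilon>\<close> by (simp add: \<eta>_def)
  then obtain \<alpha> where \<alpha>: "0 < \<alpha>"
    "\<And>i. i \<in> I \<Longrightarrow> 1 - \<eta> < measure M {x \<in> space M. L1_rep (H i) x > \<alpha>}"
    using large by blast
  define c where "c = real K / \<alpha>"
  have "0 \<le> c"
    using \<alpha>(1) by (simp add: c_def)
  obtain \<delta> where \<delta>: "0 < \<delta>"
    "\<And>A. A \<in> sets M \<Longrightarrow> measure M A < \<delta> \<Longrightarrow> (LINT x:A|M. L1_rep H0 x) < \<epsilon> / (3 * (c + 1))"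
    using integrable_small_on_small_sets[OF H0_int, of "\<epsilon> / (3 * (c + 1))"] \<open>0 < \<epsilon>\<close> \<open>0 \<le> c\<close> by auto
  have "(LINT x:A|M. L1_rep (Q i G) x) < \<epsilon>" if A: "A \<in> sets M" "measure M A < \<delta>" and i: "i \<in> I" for A i
  proof -
    let ?h = "L1_rep (H i)"
    have h_L1: "H i \<in> L1 M" and h_pos: "AE x in M. 0 \<le> ?h x"
      using H[OF i] by (auto simp: L1_pos_def)
    have h_int: "integrable M ?h"
      using h_L1 by (rule L1_rep_integrable)
    have "{x \<in> space M. ?h x > \<alpha>} \<in> sets M"
      using borel_measurable_integrable[OF h_int] by measurable
    moreover have "{x \<in> space M. ?h x \<le> \<alpha>} = space M - {x \<in> space M. ?h x > \<alpha>}"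
      by auto
    ultimately have "measure M {x \<in> space M. ?h x \<le> \<alpha>} < \<eta>"
      using \<alpha>(2)[OF i] by (simp add: prob_compl)
    then have "real K * measure M {x \<in> space M. ?h x \<le> \<alpha>} \<le> real K * \<eta>"
      by (intro mult_left_mono) auto
    also have "\<dots> \<le> \<epsilon> / 3"
      using \<open>0 < \<epsilon>\<close> by (simp add: \<eta>_def field_simps)
    finally have "(\<integral>x. max 0 (L1_rep G x - c * ?h x) \<partial>M) < 2 * \<epsilon> / 3"
      using integral_excess_over_multiple_le[OF G_int h_int h_pos \<alpha>(1), of "real K"] K
      by (simp add: c_def)
    moreover have "c * (LINT x:A|M. L1_rep H0 x) \<le> c * (\<epsilon> / (3 * (c + 1)))"
      using \<delta>(2)[OF A] \<open>0 \<le> c\<close> by (intro mult_left_mono) auto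
    moreover have "c * (\<epsilon> / (3 * (c + 1))) \<le> \<epsilon> / 3"
      using \<open>0 < \<epsilon>\<close> \<open>0 \<le> c\<close> by (simp add: field_simps)
    ultimately show ?thesis
      using markov_operator_set_integral_le[OF Q[OF i] G h_L1 A(1), of c] unfolding QH[OF i]
      by linarith
  qed
  then show "\<exists>\<delta>>0. \<forall>A\<in>sets M. measure M A < \<delta> \<longrightarrow> (\<forall>F\<in>{Q i G | i. i \<in> I}. (LINT x:A|M. L1_rep F x) < \<epsilon>)"
    using \<delta>(1) by blast
qed

section \<open>The cocycle along backward orbits\<close>

lemma markov_operator_id: "markov_operator M id"
  by (simp add: markov_operator_def)

lemma markov_operator_comp:
  "markov_operator M Q \<Longrightarrow> markov_operator M R \<Longrightarrow> markov_operator M (Q \<circ> R)"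
  by (simp add: markov_operator_def)

lemma markov_operator_cocycle_iter:
  assumes "\<And>j. j < n \<Longrightarrow> markov_operator M (P ((\<sigma> ^^ j) \<omega>))"
  shows "markov_operator M (cocycle_iter P \<sigma> n \<omega>)"
  using assms by (induction n) (simp_all add: markov_operator_id markov_operator_comp)

lemma cocycle_iter_equivariant:
  assumes "\<And>j. j < n \<Longrightarrow> P ((\<sigma> ^^ j) \<omega>) (h ((\<sigma> ^^ j) \<omega>)) = h (\<sigma> ((\<sigma> ^^ j) \<omega>))"
  shows "cocycle_iter P \<sigma> n \<omega> (h \<omega>) = h ((\<sigma> ^^ n) \<omega>)"
  using assms by (induction n) simp_all

lemma funpow_inv_cancel:
  assumes "bij \<sigma>" "j \<le> n"
  shows "(\<sigma> ^^ j) ((inv \<sigma> ^^ n) \<omega>) = (inv \<sigma> ^^ (n - j)) \<omega>"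
  using assms(2)
proof (induction j arbitrary: n)
  case (Suc j)
  then obtain m where m: "n = Suc m"
    by (cases n) auto
  have "(\<sigma> ^^ Suc j) ((inv \<sigma> ^^ Suc m) \<omega>) = (\<sigma> ^^ j) (\<sigma> (inv \<sigma> ((inv \<sigma> ^^ m) \<omega>)))"
    by (simp add: funpow_swap1)
  also have "\<dots> = (\<sigma> ^^ j) ((inv \<sigma> ^^ m) \<omega>)"
    using bij_is_surj[OF assms(1)] by (simp add: surj_f_inv_f)
  finally show ?case
    using Suc m by simp
qed simp

text \<open>
  The inverse of \<open>\<sigma>\<close> preserves the measure as well, and a countable intersection of sets of full
  measure has full measure.
\<close>

lemma AE_backward_orbit:
  assumes \<sigma>: "invertible_ergodic N \<sigma>" and Q: "AE \<omega> in N. Q \<omega>"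
  shows "AE \<omega> in N. \<forall>n. Q ((inv \<sigma> ^^ n) \<omega>)"
proof -
  have bij: "bij \<sigma>" and meas [measurable]: "\<sigma> \<in> measurable N N" "inv \<sigma> \<in> measurable N N"
    and pres: "\<And>A. A \<in> sets N \<Longrightarrow> emeasure N (\<sigma> -` A \<inter> space N) = emeasure N A"
    using \<sigma> by (auto simp: invertible_ergodic_def)
  have distr_inv: "distr N N (inv \<sigma>) = N"
  proof (rule measure_eqI)
    fix A assume "A \<in> sets (distr N N (inv \<sigma>))"
    then have A: "A \<in> sets N"
      by simp
    define B where "B = inv \<sigma> -` A \<inter> space N"
    have B: "B \<in> sets N"
      using A unfolding B_def by measurable
    have "\<sigma> -` B \<inter> space N = A"
      using sets.sets_into_space[OF A] measurable_space[OF meas(1)] bij_is_inj[OF bij]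
      by (auto simp: B_def)
    then show "emeasure (distr N N (inv \<sigma>)) A = emeasure N A"
      using A pres[OF B] by (simp add: emeasure_distr B_def)
  qed simp
  have step: "AE \<omega> in N. R (inv \<sigma> \<omega>)" if "AE \<omega> in N. R \<omega>" for R
  proof (rule AE_distrD[OF meas(2)])
    show "AE \<omega> in distr N N (inv \<sigma>). R \<omega>"
      unfolding distr_inv by (rule that)
  qed
  have "AE \<omega> in N. Q ((inv \<sigma> ^^ n) \<omega>)" for n
  proof (induction n)
    case (Suc n)
    then show ?case
      using step[of "\<lambda>\<omega>. Q ((inv \<sigma> ^^ n) \<omega>)"] by (simp add: funpow_swap1)
  qed (simp add: Q)
  then show ?thesis
    by (simp add: AE_all_countable)
qed

theorem proposition1p1:
  fixes N :: "'w::polish_space measure"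
    and M :: "'x::polish_space measure"
    and \<sigma> :: "'w \<Rightarrow> 'w"
    and P :: "'w \<Rightarrow> ('x \<Rightarrow> real) set \<Rightarrow> ('x \<Rightarrow> real) set"
    and h :: "'w \<Rightarrow> ('x \<Rightarrow> real) set"
  assumes "prob_space N" and "sets borel \<subseteq> sets N"
    and "prob_space M" and "sets borel \<subseteq> sets M"
    and "invertible_ergodic N \<sigma>"
    and "markov_operator_cocycle N M P"
    and "random_invariant_density N M P \<sigma> h"
    and "AE \<omega> in N. uniform_limit {1..}
           (\<lambda>\<alpha> n. measure M {x \<in> space M. L1_rep (h ((inv \<sigma> ^^ n) \<omega>)) x > \<alpha>})
           (\<lambda>n. 1) (at_right (0::real))"
  shows "AE \<omega> in N. \<forall>g\<in>L1_pos M.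
           L1_uniformly_integrable M {cocycle_iter P \<sigma> n ((inv \<sigma> ^^ n) \<omega>) g | n. n \<ge> 1} \<and>
           L1_weakly_precompact M {cocycle_iter P \<sigma> n ((inv \<sigma> ^^ n) \<omega>) g | n. n \<ge> 1}"
proof -
  interpret M: prob_space M
    by fact
  have "bij \<sigma>"
    using \<open>invertible_ergodic N \<sigma>\<close> by (simp add: invertible_ergodic_def)
  have "AE \<omega> in N. markov_operator M (P \<omega>) \<and> h \<omega> \<in> L1_density M \<and> P \<omega> (h \<omega>) = h (\<sigma> \<omega>)"
    using assms(6,7) by (auto simp: markov_operator_cocycle_def random_invariant_density_def)
  from AE_backward_orbit[OF assms(5) this] assms(8)
  show ?thesis
  proof (eventually_elim, intro ballI)
    fix \<omega> g
    assume orbit: "\<forall>n. markov_operator M (P ((inv \<sigma> ^^ n) \<omega>)) \<and> h ((inv \<sigma> ^^ n) \<omega>) \<in> L1_density M \<and>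
        P ((inv \<sigma> ^^ n) \<omega>) (h ((inv \<sigma> ^^ n) \<omega>)) = h (\<sigma> ((inv \<sigma> ^^ n) \<omega>))"
      and lim: "uniform_limit {1..}
           (\<lambda>\<alpha> n. measure M {x \<in> space M. L1_rep (h ((inv \<sigma> ^^ n) \<omega>)) x > \<alpha>})
           (\<lambda>n. 1) (at_right (0::real))"
      and g: "g \<in> L1_pos M"
    define Q where "Q n = cocycle_iter P \<sigma> n ((inv \<sigma> ^^ n) \<omega>)" for n
    have Q: "markov_operator M (Q n)" for n
      unfolding Q_def using orbit \<open>bij \<sigma>\<close> by (intro markov_operator_cocycle_iter) (simp add: funpow_inv_cancel)
    have Q_h: "Q n (h ((inv \<sigma> ^^ n) \<omega>)) = h \<omega>" for n
      unfolding Q_def using orbit \<open>bij \<sigma>\<close>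
      by (subst cocycle_iter_equivariant) (simp_all add: funpow_inv_cancel)
    have h_pos: "h ((inv \<sigma> ^^ n) \<omega>) \<in> L1_pos M" for n
      using orbit by (simp add: L1_density_def)
    have g_L1: "g \<in> L1 M"
      using g by (simp add: L1_pos_def)
    have ui: "L1_uniformly_integrable M {Q n g | n. n \<in> {1..}}"
    proof (rule M.markov_images_uniformly_integrable[OF Q h_pos Q_h _ _ g_L1])
      show "h \<omega> \<in> L1 M"
        using h_pos[of 0] by (simp add: L1_pos_def)
      show "\<exists>\<alpha>>0. \<forall>n\<in>{1..}. 1 - \<eta> < measure M {x \<in> space M. L1_rep (h ((inv \<sigma> ^^ n) \<omega>)) x > \<alpha>}"
        if "0 < \<eta>" for \<eta>
      proof -
        have "\<forall>\<^sub>F \<alpha> in at_right 0. 0 < \<alpha> \<and>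
            (\<forall>n\<in>{1..}. dist (measure M {x \<in> space M. L1_rep (h ((inv \<sigma> ^^ n) \<omega>)) x > \<alpha>}) 1 < \<eta>)"
          by (intro eventually_conj eventually_at_right_less uniform_limitD[OF lim that])
        then have "\<exists>\<alpha>. 0 < \<alpha> \<and>
            (\<forall>n\<in>{1..}. dist (measure M {x \<in> space M. L1_rep (h ((inv \<sigma> ^^ n) \<omega>)) x > \<alpha>}) 1 < \<eta>)"
          by (rule eventually_happens'[OF trivial_limit_at_right_real])
        then show ?thesis
          by (auto simp: dist_real_def abs_less_iff algebra_simps)
      qed
    qed
    have Q_pos: "Q n g \<in> L1_pos M" for n
      using Q g by (simp add: markov_operator_def)
    have norm_integral: "L1_norm M F = L1_integral M F" if "F \<in> L1_pos M" for F
      unfolding L1_norm_def L1_integral_def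
      using that borel_measurable_integrable[OF L1_rep_integrable[of F M]]
      by (intro integral_cong_AE) (auto simp: L1_pos_def)
    have "L1_norm M (Q n g) = L1_integral M g" for n
      using Q g_L1 by (simp add: norm_integral Q_pos markov_operator_def)
    then have "L1_weakly_precompact M {Q n g | n. n \<in> {1..}}"
      using Q_pos by (intro M.uniformly_integrable_imp_weakly_precompact[OF _ _ ui, of "L1_integral M g"]) auto
    then show "L1_uniformly_integrable M {cocycle_iter P \<sigma> n ((inv \<sigma> ^^ n) \<omega>) g | n. n \<ge> 1} \<and>
        L1_weakly_precompact M {cocycle_iter P \<sigma> n ((inv \<sigma> ^^ n) \<omega>) g | n. n \<ge> 1}"
      using ui by (simp add: Q_def)
  qed
qed

end
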